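(* Let $(I,\cdot)$ be a Cartan datum and suppose $i_1,i_2,\dots,i_n\in I$ ($n\ge2$) are distinct and form a linear tree with $i_n$ an end vertex, i.e. $$i_a\cdot i_a=i_{a+1}\cdot i_{a+1}=-2\,i_a\cdot i_{a+1}\ (1\le a<n),\qquad i_a\cdot i_b=0\ (|a-b|\neq0,1),\qquad i_a\cdot j=0\ (a\ge2,\ j\neq i_1,\dots,i_n).$$ Then for $\varepsilon\in\{\pm1\}$ $$\Psi_{\varepsilon,\{i_1,i_2\}}=T'_{i_2,-\varepsilon}T'_{i_3,-\varepsilon}\cdots T'_{i_n,-\varepsilon}\,\Upsilon_{i_n}\,S_{i_n}^{-1}S_{i_{n-1}}^{-1}\cdots S_{i_2}^{-1}.$$
   Context: A Cartan datum $(I,\cdot)$ is a finite set $I$ with a $\mathbb Z$-valued symmetric bilinear form $\cdot$ on $\mathbb Z[I]$ such that $i\cdot i\in\{2,4,6,\dots\}$ and $2\frac{i\cdot j}{i\cdot i}\in\{0,-1,-2,\dots\}$ for $i\neq j$ in $I$. A root datum of type $(I,\cdot)$: finitely generated free abelian groups $Y,X$, a perfect pairing $\langle\,,\rangle:Y\times X\to\mathbb Z$, embeddings $I\hookrightarrow Y$, $i\mapsto i$, $I\hookrightarrow X$, $i\mapsto i'$, with $\langle i,j'\rangle=2\frac{i\cdot j}{i\cdot i}$. Fix one. For $i\in I$, $s_i(\mu)=\mu-\langle\mu,i'\rangle i$ on $Y$, and $s_i(j)=j-2\frac{i\cdot j}{i\cdot i}i$ on $\mathbb Z[I]$. Let $v$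 be an indeterminate, $v_i=v^{i\cdot i/2}$, $[n]_i=\frac{v_i^n-v_i^{-n}}{v_i-v_i^{-1}}$, $x_i^{(n)}=x_i^n/[n]_i^!$. $\mathbf U_I$ is the $\mathbb Q(v)$-algebra with generators $E_i,F_i$ ($i\in I$), $K_\mu$ ($\mu\in Y$) and relations $K_0=1$, $K_\mu K_{\mu'}=K_{\mu+\mu'}$, $K_\mu E_i=v^{\langle\mu,i'\rangle}E_iK_\mu$, $K_\mu F_i=v^{-\langle\mu,i'\rangle}F_iK_\mu$, $E_iF_j-F_jE_i=\delta_{ij}\frac{\tilde K_i-\tilde K_i^{-1}}{v_i-v_i^{-1}}$ with $\tilde K_i=K_{\frac{i\cdot i}{2}i}$ ($\tilde K_{ei}=\tilde K_i^e$), and $\sum_{r+s=1-\langle i,j'\rangle}(-1)^rx_i^{(s)}x_jx_i^{(r)}=0$ for $x=E,F$, $i\neq j$. For $e=\pm1$, Lusztig's automorphism $T'_{i,e}$ of $\mathbf U_I$: $K_\mu\mapsto K_{s_i(\mu)}$, $E_i\mapsto-\tilde K_{ei}F_i$, $F_i\mapsto-E_i\tilde K_{-ei}$, and for $j\neq i$, with sums over $r+s=-\langle i,j'\rangle$, $E_j\mapsto\sum(-1)^rv_i^{er}E_i^{(r)}E_jE_i^{(s)}$, $F_j\mapsto\sum(-1)^rv_i^{-er}F_i^{(s)}F_jF_i^{(r)}$. For $1\le a\le n-1$ let $I^{(a)}=(I\setminus\{i_a,i_{a+1}\})\cup\{i_a+i_{a+1}\}\subset\mathbb Z[I]$ with the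 restricted form: the edge contraction of $(I,\cdot)$ along $\{i_a,i_{a+1}\}$; and let $I^{(n)}=I\setminus\{i_n\}$. Each is a Cartan datum with root datum on the same $Y,X$ (with $i_a+i_{a+1}\in Y$ and $(i_a+i_{a+1})'=i_a'+i_{a+1}'$), and $\mathbf U_{I^{(a)}}$ is the corresponding quantum group, with generators $E_i,F_i$ ($i\in I^{(a)}$), $K_\mu$ ($\mu\in Y$). $\Psi_{\varepsilon,\{i_1,i_2\}}:\mathbf U_{I^{(1)}}\to\mathbf U_I$ is the algebra embedding $E_i\mapsto E_i$, $F_i\mapsto F_i$ ($i\neq i_1+i_2$), $K_\mu\mapsto K_\mu$, $E_{i_1+i_2}\mapsto E_{i_1}E_{i_2}-v_{i_1}^{-\varepsilon}E_{i_2}E_{i_1}$, $F_{i_1+i_2}\mapsto F_{i_2}F_{i_1}-v_{i_1}^{\varepsilon}F_{i_1}F_{i_2}$. For $2\le a\le n$, $s_{i_a}$ restricts to an isomorphism of Cartan data $I^{(a)}\to I^{(a-1)}$ and $S_{i_a}:\mathbf U_{I^{(a)}}\to\mathbf U_{I^{(a-1)}}$ is the algebra isomorphism $E_i\mapsto E_{s_{i_a}(i)}$, $F_i\mapsto F_{s_{i_a}(i)}$, $K_\mu\mapsto K_{s_{i_a}(\mu)}$. $\Upsilon_{i_n}:\mathbf U_{I^{(n)}}\to\mathbf U_I$ is the embedding $E_i\mapsto E_i$, $F_i\mapsto F_i$, $K_\mu\mapsto K_\mu$. *)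

theory Defs
  imports
    "HOL-Algebra.QuotRing"
    "HOL-Algebra.Free_Abelian_Groups"
    "HOL-Computational_Algebra.Polynomial"
    "HOL-Computational_Algebra.Fraction_Field"
begin

section \<open>Root data\<close>

text \<open>
  The lattice \<open>\<int>[I]\<close> is the carrier of the free Abelian group on \<open>I\<close>, inside the type
  \<open>'i \<Rightarrow>\<^sub>0 int\<close>; an index \<open>i\<close>, regarded as an element of the lattice, is \<open>frag_of i\<close>.
\<close>

abbreviation lattice :: "'i set \<Rightarrow> ('i \<Rightarrow>\<^sub>0 int) set" where
  "lattice I \<equiv> carrier (free_Abelian_group I)"

definition cartan_datum :: "'i set \<Rightarrow> (('i \<Rightarrow>\<^sub>0 int) \<Rightarrow> ('i \<Rightarrow>\<^sub>0 int) \<Rightarrow> int) \<Rightarrow> bool" where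
  "cartan_datum I B \<longleftrightarrow>
     finite I \<and>
     (\<forall>x\<in>lattice I. \<forall>y\<in>lattice I. B x y = B y x) \<and>
     (\<forall>x\<in>lattice I. \<forall>y\<in>lattice I. \<forall>z\<in>lattice I. B (x + y) z = B x z + B y z) \<and>
     (\<forall>i\<in>I. B (frag_of i) (frag_of i) > 0 \<and> even (B (frag_of i) (frag_of i))) \<and>
     (\<forall>i\<in>I. \<forall>j\<in>I. i \<noteq> j \<longrightarrow>
        (\<exists>m::nat. 2 * B (frag_of i) (frag_of j) = - int m * B (frag_of i) (frag_of i)))"

definition zscale :: "int \<Rightarrow> 'a::ab_group_add \<Rightarrow> 'a" where
  "zscale n x = (if n \<ge> 0 then (\<Sum>_<nat n. x) else - (\<Sum>_<nat (- n). x))"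

text \<open>The underlying group of a type is free of finite rank.\<close>

definition fg_free :: "'a::ab_group_add itself \<Rightarrow> bool" where
  "fg_free _ \<longleftrightarrow>
     (\<exists>b :: 'a set. finite b \<and>
        (\<forall>x :: 'a. \<exists>!c :: 'a \<Rightarrow> int. (\<forall>a. a \<notin> b \<longrightarrow> c a = 0) \<and> x = (\<Sum>a\<in>b. zscale (c a) a)))"

definition perfect_pairing :: "('y::ab_group_add \<Rightarrow> 'x::ab_group_add \<Rightarrow> int) \<Rightarrow> bool" where
  "perfect_pairing p \<longleftrightarrow>
     (\<forall>\<mu>. additive (p \<mu>)) \<and> (\<forall>\<xi>. additive (\<lambda>\<mu>. p \<mu> \<xi>)) \<and>
     (\<forall>f. additive f \<longrightarrow> (\<exists>!\<mu>. p \<mu> = f)) \<and>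
     (\<forall>g. additive g \<longrightarrow> (\<exists>!\<xi>. (\<lambda>\<mu>. p \<mu> \<xi>) = g))"

text \<open>The lattices \<open>Y\<close> and \<open>X\<close> are the types \<open>'y\<close> and \<open>'x\<close>;
  \<open>ydir\<close> and \<open>xdir\<close> are the maps \<open>i \<mapsto> i\<close> and \<open>i \<mapsto> i'\<close>.\<close>

record ('i, 'y, 'x) root_datum =
  simples :: "'i set"
  form :: "('i \<Rightarrow>\<^sub>0 int) \<Rightarrow> ('i \<Rightarrow>\<^sub>0 int) \<Rightarrow> int"
  ydir :: "'i \<Rightarrow> 'y"
  xdir :: "'i \<Rightarrow> 'x"
  pairing :: "'y \<Rightarrow> 'x \<Rightarrow> int"

definition is_root_datum :: "('i, 'y::ab_group_add, 'x::ab_group_add) root_datum \<Rightarrow> bool" where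
  "is_root_datum R \<longleftrightarrow>
     cartan_datum (simples R) (form R) \<and>
     fg_free TYPE('y) \<and> fg_free TYPE('x) \<and>
     perfect_pairing (pairing R) \<and>
     inj_on (ydir R) (simples R) \<and> inj_on (xdir R) (simples R) \<and>
     (\<forall>i\<in>simples R. \<forall>j\<in>simples R.
        pairing R (ydir R i) (xdir R j) * form R (frag_of i) (frag_of i)
          = 2 * form R (frag_of i) (frag_of j))"

text \<open>Linear extensions of \<open>ydir\<close> and \<open>xdir\<close> to the lattice \<open>\<int>[I]\<close>.\<close>

definition yel :: "('i, 'y::ab_group_add, 'x) root_datum \<Rightarrow> ('i \<Rightarrow>\<^sub>0 int) \<Rightarrow> 'y" where
  "yel R q = (\<Sum>i\<in>Poly_Mapping.keys q. zscale (Poly_Mapping.lookup q i) (ydir R i))"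

definition xel :: "('i, 'y, 'x::ab_group_add) root_datum \<Rightarrow> ('i \<Rightarrow>\<^sub>0 int) \<Rightarrow> 'x" where
  "xel R q = (\<Sum>i\<in>Poly_Mapping.keys q. zscale (Poly_Mapping.lookup q i) (xdir R i))"

definition refl_Y :: "('i, 'y::ab_group_add, 'x) root_datum \<Rightarrow> 'i \<Rightarrow> 'y \<Rightarrow> 'y" where
  "refl_Y R i \<mu> = \<mu> - zscale (pairing R \<mu> (xdir R i)) (ydir R i)"

text \<open>The division is exact on \<open>\<int>[I]\<close>, so this is the linear extension of
  \<open>j \<mapsto> j - 2 (i \<cdot> j) / (i \<cdot> i) i\<close>.\<close>

definition refl_L :: "('i, 'y, 'x) root_datum \<Rightarrow> 'i \<Rightarrow> ('i \<Rightarrow>\<^sub>0 int) \<Rightarrow> ('i \<Rightarrow>\<^sub>0 int)" where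
  "refl_L R i q =
     q - frag_cmul (2 * form R (frag_of i) q div form R (frag_of i) (frag_of i)) (frag_of i)"


section \<open>Free algebras over \<open>\<rat>(v)\<close>\<close>

type_synonym qv = "rat poly fract"

definition v :: qv where
  "v = Fract [:0, 1:] 1"

definition qint :: "qv \<Rightarrow> nat \<Rightarrow> qv" where
  "qint w n = (w ^ n - inverse w ^ n) / (w - inverse w)"

definition qfact :: "qv \<Rightarrow> nat \<Rightarrow> qv" where
  "qfact w n = (\<Prod>k=1..n. qint w k)"

datatype ('q, 'y) gen = GenE 'q | GenF 'q | GenK 'y

text \<open>Words form the free monoid, written additively so that the convolution product on finitely
  supported functions makes \<open>'g word \<Rightarrow>\<^sub>0 qv\<close> the free associative algebra on \<open>'g\<close>.\<close>

datatype 'g word = Word (letters: "'g list")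

instantiation word :: (type) monoid_add
begin
definition zero_word :: "'a word" where "zero_word = Word []"
definition plus_word :: "'a word \<Rightarrow> 'a word \<Rightarrow> 'a word" where
  "plus_word a b = Word (letters a @ letters b)"
instance by standard (simp_all add: zero_word_def plus_word_def)
end

type_synonym ('q, 'y) falg = "('q, 'y) gen word \<Rightarrow>\<^sub>0 qv"

definition gE :: "'q \<Rightarrow> ('q, 'y) falg" where
  "gE q = Poly_Mapping.single (Word [GenE q]) 1"
definition gF :: "'q \<Rightarrow> ('q, 'y) falg" where
  "gF q = Poly_Mapping.single (Word [GenF q]) 1"
definition gK :: "'y \<Rightarrow> ('q, 'y) falg" where
  "gK \<mu> = Poly_Mapping.single (Word [GenK \<mu>]) 1"

definition const :: "qv \<Rightarrow> ('q, 'y) falg" where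
  "const c = Poly_Mapping.single 0 c"

text \<open>Divided power \<open>p\<^sup>n / [n]!\<close>, with quantum factorial in the variable \<open>w\<close>.\<close>

definition dpow :: "qv \<Rightarrow> ('q, 'y) falg \<Rightarrow> nat \<Rightarrow> ('q, 'y) falg" where
  "dpow w p n = const (inverse (qfact w n)) * p ^ n"

text \<open>The subalgebra generated by \<open>E\<^sub>q, F\<^sub>q\<close> with \<open>q \<in> J\<close> and all \<open>K\<^sub>\<mu>\<close>.\<close>

definition free_alg :: "'q set \<Rightarrow> ('q, 'y) falg ring" where
  "free_alg J =
     \<lparr>carrier = {p. \<forall>w\<in>Poly_Mapping.keys p. set (letters w) \<subseteq> GenE ` J \<union> GenF ` J \<union> GenK ` UNIV},
      monoid.mult = (*), monoid.one = 1, ring.zero = 0, ring.add = (+)\<rparr>"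


section \<open>Quantum groups\<close>

text \<open>
  All quantum groups attached to a root datum \<open>R\<close> are indexed by subsets \<open>J\<close> of the lattice
  \<open>\<int>[I]\<close>, with the restricted form and with the linearly extended maps to \<open>Y\<close> and \<open>X\<close>.
\<close>

definition vpar :: "('i, 'y, 'x) root_datum \<Rightarrow> ('i \<Rightarrow>\<^sub>0 int) \<Rightarrow> qv" where
  "vpar R q = v powi (form R q q div 2)"

text \<open>\<open>Ktil R q e\<close> is the \<open>e\<close>-th power of \<open>K\<^sub>\<mu>\<close> for \<open>\<mu> = (q \<cdot> q / 2) q\<close>.\<close>

definition Ktil :: "('i, 'y::ab_group_add, 'x) root_datum \<Rightarrow> ('i \<Rightarrow>\<^sub>0 int) \<Rightarrow> int
    \<Rightarrow> ('i \<Rightarrow>\<^sub>0 int, 'y) falg" where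
  "Ktil R q e = gK (zscale (e * (form R q q div 2)) (yel R q))"

definition serre :: "('i, 'y::ab_group_add, 'x::ab_group_add) root_datum
    \<Rightarrow> (('i \<Rightarrow>\<^sub>0 int) \<Rightarrow> ('i \<Rightarrow>\<^sub>0 int, 'y) falg) \<Rightarrow> ('i \<Rightarrow>\<^sub>0 int) \<Rightarrow> ('i \<Rightarrow>\<^sub>0 int)
    \<Rightarrow> ('i \<Rightarrow>\<^sub>0 int, 'y) falg" where
  "serre R x p q =
     (let m = nat (1 - pairing R (yel R p) (xel R q)) in
      \<Sum>r\<le>m. (- 1) ^ r * dpow (vpar R p) (x p) (m - r) * x q * dpow (vpar R p) (x p) r)"

definition relators :: "('i, 'y::ab_group_add, 'x::ab_group_add) root_datum \<Rightarrow> ('i \<Rightarrow>\<^sub>0 int) set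
    \<Rightarrow> ('i \<Rightarrow>\<^sub>0 int, 'y) falg set" where
  "relators R J =
     {gK 0 - 1}
     \<union> {gK \<mu> * gK \<nu> - gK (\<mu> + \<nu>) |\<mu> \<nu>. True}
     \<union> {gK \<mu> * gE q - const (v powi pairing R \<mu> (xel R q)) * gE q * gK \<mu> |\<mu> q. q \<in> J}
     \<union> {gK \<mu> * gF q - const (v powi (- pairing R \<mu> (xel R q))) * gF q * gK \<mu> |\<mu> q. q \<in> J}
     \<union> {gE q * gF q
          - gF q * gE q
          - const (inverse (vpar R q - inverse (vpar R q))) * (Ktil R q 1 - Ktil R q (- 1)) |q. q \<in> J}
     \<union> {gE p * gF q - gF q * gE p |p q. p \<in> J \<and> q \<in> J \<and> p \<noteq> q}
     \<union> {serre R gE p q |p q. p \<in> J \<and> q \<in> J \<and> p \<noteq> q}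
     \<union> {serre R gF p q |p q. p \<in> J \<and> q \<in> J \<and> p \<noteq> q}"

definition rel_ideal :: "('i, 'y::ab_group_add, 'x::ab_group_add) root_datum \<Rightarrow> ('i \<Rightarrow>\<^sub>0 int) set
    \<Rightarrow> ('i \<Rightarrow>\<^sub>0 int, 'y) falg set" where
  "rel_ideal R J = genideal (free_alg J) (relators R J)"

definition QG :: "('i, 'y::ab_group_add, 'x::ab_group_add) root_datum \<Rightarrow> ('i \<Rightarrow>\<^sub>0 int) set
    \<Rightarrow> ('i \<Rightarrow>\<^sub>0 int, 'y) falg set ring" where
  "QG R J = free_alg J Quot rel_ideal R J"

definition cls :: "('i, 'y::ab_group_add, 'x::ab_group_add) root_datum \<Rightarrow> ('i \<Rightarrow>\<^sub>0 int) set
    \<Rightarrow> ('i \<Rightarrow>\<^sub>0 int, 'y) falg \<Rightarrow> ('i \<Rightarrow>\<^sub>0 int, 'y) falg set" where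
  "cls R J p = rel_ideal R J +>\<^bsub>free_alg J\<^esub> p"

text \<open>Homomorphisms of unital \<open>\<rat>(v)\<close>-algebras: ring homomorphisms fixing the scalars.\<close>

definition alg_hom :: "('i, 'y::ab_group_add, 'x::ab_group_add) root_datum
    \<Rightarrow> ('i \<Rightarrow>\<^sub>0 int) set \<Rightarrow> ('i \<Rightarrow>\<^sub>0 int) set
    \<Rightarrow> (('i \<Rightarrow>\<^sub>0 int, 'y) falg set \<Rightarrow> ('i \<Rightarrow>\<^sub>0 int, 'y) falg set) set" where
  "alg_hom R J J' =
     {h \<in> ring_hom (QG R J) (QG R J'). \<forall>c. h (cls R J (const c)) = cls R J' (const c)}"


section \<open>The maps\<close>

abbreviation idx :: "('i, 'y, 'x) root_datum \<Rightarrow> ('i \<Rightarrow>\<^sub>0 int) set" where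
  "idx R \<equiv> frag_of ` simples R"

definition contract :: "('i, 'y, 'x) root_datum \<Rightarrow> 'i \<Rightarrow> 'i \<Rightarrow> ('i \<Rightarrow>\<^sub>0 int) set" where
  "contract R i j = frag_of ` (simples R - {i, j}) \<union> {frag_of i + frag_of j}"

definition delete :: "('i, 'y, 'x) root_datum \<Rightarrow> 'i \<Rightarrow> ('i \<Rightarrow>\<^sub>0 int) set" where
  "delete R i = frag_of ` (simples R - {i})"

text \<open>
  Each of the following predicates characterises an algebra homomorphism by its values on
  generators, hence uniquely on the carrier. Bijectivity of \<open>T'\<close> and injectivity of \<open>\<Psi>\<close> and
  \<open>\<Upsilon>\<close> are not required.
\<close>

definition is_braid :: "('i, 'y::ab_group_add, 'x::ab_group_add) root_datum \<Rightarrow> 'i \<Rightarrow> int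
    \<Rightarrow> (('i \<Rightarrow>\<^sub>0 int, 'y) falg set \<Rightarrow> ('i \<Rightarrow>\<^sub>0 int, 'y) falg set) \<Rightarrow> bool" where
  "is_braid R i e T \<longleftrightarrow>
     (let c = cls R (idx R); fi = frag_of i; w = vpar R fi in
      T \<in> alg_hom R (idx R) (idx R) \<and>
      (\<forall>\<mu>. T (c (gK \<mu>)) = c (gK (refl_Y R i \<mu>))) \<and>
      T (c (gE fi)) = c (- (Ktil R fi e * gF fi)) \<and>
      T (c (gF fi)) = c (- (gE fi * Ktil R fi (- e))) \<and>
      (\<forall>j\<in>simples R - {i}.
         let fj = frag_of j; m = nat (- pairing R (ydir R i) (xdir R j)) in
         T (c (gE fj)) = c (\<Sum>r\<le>m. const ((- 1) ^ r * w powi (e * int r)) *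
                              dpow w (gE fi) r * gE fj * dpow w (gE fi) (m - r)) \<and>
         T (c (gF fj)) = c (\<Sum>r\<le>m. const ((- 1) ^ r * w powi (- e * int r)) *
                              dpow w (gF fi) (m - r) * gF fj * dpow w (gF fi) r)))"

definition is_Psi :: "('i, 'y::ab_group_add, 'x::ab_group_add) root_datum \<Rightarrow> int \<Rightarrow> 'i \<Rightarrow> 'i
    \<Rightarrow> (('i \<Rightarrow>\<^sub>0 int, 'y) falg set \<Rightarrow> ('i \<Rightarrow>\<^sub>0 int, 'y) falg set) \<Rightarrow> bool" where
  "is_Psi R \<epsilon> i j \<Psi> \<longleftrightarrow>
     (let J = contract R i j; c = cls R (idx R);
          fi = frag_of i; fj = frag_of j; w = vpar R fi in
      \<Psi> \<in> alg_hom R J (idx R) \<and>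
      (\<forall>\<mu>. \<Psi> (cls R J (gK \<mu>)) = c (gK \<mu>)) \<and>
      (\<forall>k\<in>simples R - {i, j}.
         \<Psi> (cls R J (gE (frag_of k))) = c (gE (frag_of k)) \<and>
         \<Psi> (cls R J (gF (frag_of k))) = c (gF (frag_of k))) \<and>
      \<Psi> (cls R J (gE (fi + fj))) = c (gE fi * gE fj - const (w powi (- \<epsilon>)) * gE fj * gE fi) \<and>
      \<Psi> (cls R J (gF (fi + fj))) = c (gF fj * gF fi - const (w powi \<epsilon>) * gF fi * gF fj))"

definition is_Upsilon :: "('i, 'y::ab_group_add, 'x::ab_group_add) root_datum \<Rightarrow> 'i
    \<Rightarrow> (('i \<Rightarrow>\<^sub>0 int, 'y) falg set \<Rightarrow> ('i \<Rightarrow>\<^sub>0 int, 'y) falg set) \<Rightarrow> bool" where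
  "is_Upsilon R i \<Upsilon> \<longleftrightarrow>
     (let J = delete R i; c = cls R (idx R) in
      \<Upsilon> \<in> alg_hom R J (idx R) \<and>
      (\<forall>\<mu>. \<Upsilon> (cls R J (gK \<mu>)) = c (gK \<mu>)) \<and>
      (\<forall>q\<in>J. \<Upsilon> (cls R J (gE q)) = c (gE q) \<and> \<Upsilon> (cls R J (gF q)) = c (gF q)))"

definition is_S :: "('i, 'y::ab_group_add, 'x::ab_group_add) root_datum \<Rightarrow> 'i
    \<Rightarrow> ('i \<Rightarrow>\<^sub>0 int) set \<Rightarrow> ('i \<Rightarrow>\<^sub>0 int) set
    \<Rightarrow> (('i \<Rightarrow>\<^sub>0 int, 'y) falg set \<Rightarrow> ('i \<Rightarrow>\<^sub>0 int, 'y) falg set) \<Rightarrow> bool" where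
  "is_S R i J J' S \<longleftrightarrow>
     S \<in> alg_hom R J J' \<and>
     bij_betw S (carrier (QG R J)) (carrier (QG R J')) \<and>
     (\<forall>\<mu>. S (cls R J (gK \<mu>)) = cls R J' (gK (refl_Y R i \<mu>))) \<and>
     (\<forall>q\<in>J. S (cls R J (gE q)) = cls R J' (gE (refl_L R i q)) \<and>
            S (cls R J (gF q)) = cls R J' (gF (refl_L R i q)))"

text \<open>The index sets \<open>I\<^bsup>(a)\<^esup>\<close>, for \<open>1 \<le> a \<le> n\<close>.\<close>

definition chain_idx :: "('i, 'y, 'x) root_datum \<Rightarrow> (nat \<Rightarrow> 'i) \<Rightarrow> nat \<Rightarrow> nat \<Rightarrow> ('i \<Rightarrow>\<^sub>0 int) set" where
  "chain_idx R i n a = (if a = n then delete R (i n) else contract R (i a) (i (Suc a)))"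

text \<open>\<open>i\<^sub>1, \<dots>, i\<^sub>n\<close> form a linear tree with end vertex \<open>i\<^sub>n\<close>.\<close>

definition linear_tree :: "('i, 'y, 'x) root_datum \<Rightarrow> (nat \<Rightarrow> 'i) \<Rightarrow> nat \<Rightarrow> bool" where
  "linear_tree R i n \<longleftrightarrow>
     (let B = (\<lambda>j k. form R (frag_of j) (frag_of k)) in
      i ` {1..n} \<subseteq> simples R \<and> inj_on i {1..n} \<and>
      (\<forall>a\<in>{1..<n}. B (i a) (i a) = B (i (Suc a)) (i (Suc a)) \<and>
                   B (i (Suc a)) (i (Suc a)) = - 2 * B (i a) (i (Suc a))) \<and>
      (\<forall>a\<in>{1..n}. \<forall>b\<in>{1..n}. \<bar>int a - int b\<bar> \<notin> {0, 1} \<longrightarrow> B (i a) (i b) = 0) \<and>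
      (\<forall>a\<in>{2..n}. \<forall>j\<in>simples R - i ` {1..n}. B (i a) j = 0))"

end

theory Submission
  imports Defs
begin

text \<open>
  Both sides are homomorphisms of \<open>\<rat>(v)\<close>-algebras, so they agree as soon as they agree on
  \<open>E\<^sub>q\<close>, \<open>F\<^sub>q\<close> and \<open>K\<^sub>\<mu>\<close> (lemma \<open>alg_hom_unique\<close>). Write \<open>i\<^sub>1, \<dots>, i\<^sub>n\<close> for the vertices of the
  tree and \<open>e = - \<epsilon>\<close>.

  On index sets, the inverses of \<open>S\<^sub>2, \<dots>, S\<^sub>n\<close> apply one simple reflection after another: the
  contracted vertex \<open>i\<^sub>1 + i\<^sub>2\<close> becomes \<open>i\<^sub>1\<close>, a later vertex \<open>i\<^sub>m\<^sub>+\<^sub>1\<close> first absorbs its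
  neighbour, becoming \<open>i\<^sub>m + i\<^sub>m\<^sub>+\<^sub>1\<close>, and then loses itself, becoming \<open>i\<^sub>m\<close>; every vertex outside
  the tree is fixed. So the tree is shifted by one place towards \<open>i\<^sub>1\<close>, which leaves \<open>i\<^sub>n\<close> free
  (lemmas \<open>S_inv_upto_first\<close>, \<open>S_inv_upto_tree\<close>, \<open>S_inv_upto_outside\<close>).

  The braid operators undo the shift. An operator \<open>T\<^sub>a\<close> fixes the generators of every vertex that is
  orthogonal to \<open>i\<^sub>a\<close>, so only \<open>T\<^sub>m T\<^sub>m\<^sub>+\<^sub>1\<close> acts on the generators of \<open>i\<^sub>m\<close>, until they have been
  moved to \<open>i\<^sub>m\<^sub>+\<^sub>1\<close>, which the remaining operators fix. This rests on the one real computation, the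
  identity \<open>T\<^sub>i T\<^sub>j (E\<^sub>i) = E\<^sub>j\<close> and its analogue for \<open>F\<close> along a simply laced edge
  (\<open>braid_braid_edge\<close>). The generators of \<open>i\<^sub>1\<close> meet only \<open>T\<^sub>2\<close>, whose values on them are
  the commutators, twisted by a power of \<open>v\<close>, that \<open>\<Psi>\<close> assigns to \<open>i\<^sub>1 + i\<^sub>2\<close> (\<open>braids_first\<close>). On \<open>K\<^sub>\<mu>\<close> the composite is a
  word in involutions followed by its inverse (\<open>refl_Y_cancel\<close>).

  Elements of a quantum group are cosets of the free algebra. All computations are carried out on
  representatives, with the congruence \<open>qg_eq\<close> in place of equality and the relation \<open>sends\<close> in place
  of the value of a homomorphism.
\<close>

section \<open>Scalars and generators of the free algebra\<close>

lemma sum_singles: "p = (\<Sum>k\<in>Poly_Mapping.keys p. Poly_Mapping.single k (Poly_Mapping.lookup p k))"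
proof (rule poly_mapping_eqI)
  fix w
  have "(\<Sum>k\<in>Poly_Mapping.keys p. Poly_Mapping.lookup p k when k = w) = Poly_Mapping.lookup p w"
    by (cases "w \<in> Poly_Mapping.keys p") (auto simp: when_def in_keys_iff)
  then show "Poly_Mapping.lookup p w =
      Poly_Mapping.lookup (\<Sum>k\<in>Poly_Mapping.keys p. Poly_Mapping.single k (Poly_Mapping.lookup p k)) w"
    by (simp add: lookup_sum lookup_single)
qed

text \<open>
  A scalar is supported on the empty word, which commutes with every word.
\<close>

lemma const_central:
  fixes p :: "('q, 'y) falg"
  shows "const c * p = p * const c"
proof -
  have "const c * Poly_Mapping.single k a = Poly_Mapping.single k a * const c"
    for k :: "('q, 'y) gen word" and a
    by (simp add: const_def mult_single mult.commute)
  then have "const c * (\<Sum>k\<in>K. Poly_Mapping.single k (f k)) = (\<Sum>k\<in>K. Poly_Mapping.single k (f k)) * const c"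
    for K :: "('q, 'y) gen word set" and f
    by (simp add: sum_distrib_left sum_distrib_right)
  from this[of "Poly_Mapping.lookup p" "Poly_Mapping.keys p"] show ?thesis
    by (simp flip: sum_singles)
qed

lemma const_simps [simp]: "const 1 = 1" "const 0 = 0"
  by (simp_all add: const_def)

lemma const_mult: "const a * const b = const (a * b)"
  by (simp add: const_def mult_single)

lemma const_add: "const a + const b = const (a + b)"
  by (simp add: const_def single_add)

text \<open>
  Multiplication by a scalar gets its own name so that the simplifier can pull central factors out of
  noncommutative products without looping.
\<close>

definition scal :: "qv \<Rightarrow> ('q, 'y) falg \<Rightarrow> ('q, 'y) falg" where
  "scal c p = const c * p"

lemma const_mult_eq_scal: "const c * p = scal c p"
  by (simp add: scal_def)

lemma scal_simps [simp]:
  "scal 1 p = p"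
  "scal c p * q = scal c (p * q)"
  "p * scal c q = scal c (p * q)"
  "scal a (scal b p) = scal (a * b) p"
  "scal c (p + q) = scal c p + scal c q"
  "scal c (p - q) = scal c p - scal c q"
  "scal c (- p) = - scal c p"
proof -
  show "p * scal c q = scal c (p * q)"
    unfolding scal_def by (metis const_central mult.assoc)
  show "scal a (scal b p) = scal (a * b) p"
    by (simp add: scal_def mult.assoc flip: const_mult)
qed (simp_all add: scal_def mult.assoc distrib_left right_diff_distrib)

lemma scal_add_left: "scal (a + b) p = scal a p + scal b p"
  by (simp add: scal_def distrib_right flip: const_add)

lemma scal_diff_left: "scal (a - b) p = scal a p - scal b p"
  using scal_add_left[of "a - b" b p] by (simp add: algebra_simps)

lemma scal_minus_left: "scal (- a) p = - scal a p"
  using scal_diff_left[of 0 a p] unfolding scal_def by simp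

lemma free_alg_sel [simp]:
  "monoid.mult (free_alg J) = (*)" "monoid.one (free_alg J) = 1"
  "ring.zero (free_alg J) = 0" "ring.add (free_alg J) = (+)"
  by (simp_all add: free_alg_def)

lemma free_alg_carrier_iff:
  "p \<in> carrier (free_alg J) \<longleftrightarrow>
     (\<forall>w\<in>Poly_Mapping.keys p. set (letters w) \<subseteq> GenE ` J \<union> GenF ` J \<union> GenK ` UNIV)"
  by (simp add: free_alg_def)

lemma letters_zero: "letters 0 = []" and letters_plus: "letters (a + b) = letters a @ letters b"
  by (simp_all add: zero_word_def plus_word_def)

lemma free_alg_closed [simp]:
  "p \<in> carrier (free_alg J) \<Longrightarrow> q \<in> carrier (free_alg J) \<Longrightarrow> p + q \<in> carrier (free_alg J)"
  "p \<in> carrier (free_alg J) \<Longrightarrow> - p \<in> carrier (free_alg J)"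
  "p \<in> carrier (free_alg J) \<Longrightarrow> q \<in> carrier (free_alg J) \<Longrightarrow> p - q \<in> carrier (free_alg J)"
  "p \<in> carrier (free_alg J) \<Longrightarrow> q \<in> carrier (free_alg J) \<Longrightarrow> p * q \<in> carrier (free_alg J)"
  "0 \<in> carrier (free_alg J)" "1 \<in> carrier (free_alg J)" "const c \<in> carrier (free_alg J)"
  "gK \<mu> \<in> carrier (free_alg J)"
  "x \<in> J \<Longrightarrow> gE x \<in> carrier (free_alg J)" "x \<in> J \<Longrightarrow> gF x \<in> carrier (free_alg J)"
proof -
  show "p + q \<in> carrier (free_alg J)" if "p \<in> carrier (free_alg J)" "q \<in> carrier (free_alg J)"
    for p q :: "('a, 'b) falg"
    using that keys_add[of p q] unfolding free_alg_carrier_iff by blast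
  then show "p - q \<in> carrier (free_alg J)" if "p \<in> carrier (free_alg J)" "q \<in> carrier (free_alg J)"
    for p q :: "('a, 'b) falg"
    using that keys_diff[of p q] unfolding free_alg_carrier_iff by blast
  show "p * q \<in> carrier (free_alg J)" if "p \<in> carrier (free_alg J)" "q \<in> carrier (free_alg J)"
    for p q :: "('a, 'b) falg"
    unfolding free_alg_carrier_iff
  proof
    fix w assume "w \<in> Poly_Mapping.keys (p * q)"
    then obtain a b where "a \<in> Poly_Mapping.keys p" "b \<in> Poly_Mapping.keys q" "w = a + b"
      using keys_mult[of p q] by blast
    then show "set (letters w) \<subseteq> GenE ` J \<union> GenF ` J \<union> GenK ` UNIV"
      using that unfolding free_alg_carrier_iff by (simp add: letters_plus)
  qed
qed (auto simp: free_alg_carrier_iff const_def gE_def gF_def gK_def letters_zero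
      simp flip: single_one split: if_splits)

lemma free_alg_closed_derived [simp]:
  "p \<in> carrier (free_alg J) \<Longrightarrow> scal c p \<in> carrier (free_alg J)"
  "p \<in> carrier (free_alg J) \<Longrightarrow> p ^ m \<in> carrier (free_alg J)"
  "p \<in> carrier (free_alg J) \<Longrightarrow> dpow w p m \<in> carrier (free_alg J)"
proof -
  show pow: "p ^ m \<in> carrier (free_alg J)" if "p \<in> carrier (free_alg J)" for p :: "('a, 'b) falg" and m
    using that by (induction m) auto
  show "p \<in> carrier (free_alg J) \<Longrightarrow> dpow w p m \<in> carrier (free_alg J)"
    by (simp add: dpow_def pow)
qed (simp_all add: scal_def)

lemma Ktil_closed [simp]: "Ktil R q e \<in> carrier (free_alg J)"
  by (simp add: Ktil_def)

lemma free_alg_sum_closed [simp]: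
  "(\<And>a. a \<in> A \<Longrightarrow> f a \<in> carrier (free_alg J)) \<Longrightarrow> sum f A \<in> carrier (free_alg J)"
  by (induction A rule: infinite_finite_induct) auto

lemma ring_free_alg: "ring (free_alg J)"
proof (rule ringI)
  show "abelian_group (free_alg J)"
  proof (rule abelian_groupI)
    show "\<exists>y\<in>carrier (free_alg J). y \<oplus>\<^bsub>free_alg J\<^esub> x = \<zero>\<^bsub>free_alg J\<^esub>" if "x \<in> carrier (free_alg J)" for x
      using that by (intro bexI[of _ "- x"]) simp_all
  qed (simp_all add: add.assoc add.commute)
  show "Group.monoid (free_alg J)"
    by (rule monoidI) (simp_all add: mult.assoc)
qed (simp_all add: algebra_simps)

lemma free_alg_minus [simp]:
  assumes "p \<in> carrier (free_alg J)" "q \<in> carrier (free_alg J)"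
  shows "p \<ominus>\<^bsub>free_alg J\<^esub> q = p - q"
proof -
  interpret ring "free_alg J" by (rule ring_free_alg)
  have "\<ominus>\<^bsub>free_alg J\<^esub> q = - q"
    by (rule minus_equality) (simp_all add: assms)
  then show ?thesis
    by (simp add: a_minus_def)
qed

text \<open>
  Two ring homomorphisms can be compared with this rule because the free algebra is spanned by
  products of generators; there is no case for negation since \<open>- p\<close> is \<open>const (- 1) * p\<close>.
\<close>

lemma free_alg_induct [consumes 1, case_names const E F K add mult]:
  assumes p: "p \<in> carrier (free_alg J)"
    and const: "\<And>c. P (const c)"
    and E: "\<And>q. q \<in> J \<Longrightarrow> P (gE q)" and F: "\<And>q. q \<in> J \<Longrightarrow> P (gF q)" and K: "\<And>\<mu>. P (gK \<mu>)"
    and add: "\<And>p q. p \<in> carrier (free_alg J) \<Longrightarrow> q \<in> carrier (free_alg J) \<Longrightarrow> P p \<Longrightarrow> P q \<Longrightarrow> P (p + q)"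
    and mult: "\<And>p q. p \<in> carrier (free_alg J) \<Longrightarrow> q \<in> carrier (free_alg J) \<Longrightarrow> P p \<Longrightarrow> P q \<Longrightarrow> P (p * q)"
  shows "P p"
proof -
  have gen: "Poly_Mapping.single (Word [g]) 1 \<in> carrier (free_alg J) \<and> P (Poly_Mapping.single (Word [g]) 1)"
    if "g \<in> GenE ` J \<union> GenF ` J \<union> GenK ` UNIV" for g
    using that E F K by (auto simp flip: gE_def gF_def gK_def)
  have word: "Poly_Mapping.single (Word gs) a \<in> carrier (free_alg J) \<and> P (Poly_Mapping.single (Word gs) a)"
    if "set gs \<subseteq> GenE ` J \<union> GenF ` J \<union> GenK ` UNIV" for gs a
    using that
  proof (induction gs)
    case Nil
    then show ?case
      using const[of a] by (simp add: const_def zero_word_def free_alg_carrier_iff)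
  next
    case (Cons g gs)
    have "Poly_Mapping.single (Word (g # gs)) a
        = Poly_Mapping.single (Word [g]) 1 * Poly_Mapping.single (Word gs) a"
      by (simp add: mult_single plus_word_def)
    then show ?case
      using Cons gen[of g] mult by simp
  qed
  have "(\<Sum>k\<in>K. Poly_Mapping.single k (Poly_Mapping.lookup p k)) \<in> carrier (free_alg J) \<and>
      P (\<Sum>k\<in>K. Poly_Mapping.single k (Poly_Mapping.lookup p k))"
    if "finite K" "K \<subseteq> Poly_Mapping.keys p" for K
    using that
  proof (induction K)
    case empty
    then show ?case using const[of 0] by simp
  next
    case (insert k K)
    then have "set (letters k) \<subseteq> GenE ` J \<union> GenF ` J \<union> GenK ` UNIV"
      using p by (auto simp: free_alg_carrier_iff)
    then have "Poly_Mapping.single k a \<in> carrier (free_alg J) \<and> P (Poly_Mapping.single k a)" for a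
      using word[of "letters k" a] by simp
    then show ?case
      using insert add by simp
  qed
  from this[of "Poly_Mapping.keys p"] show ?thesis
    by (simp flip: sum_singles)
qed

section \<open>Congruence modulo the defining relations\<close>

text \<open>
  The ideal generated by a set has its usual meaning only if the set lies in the ring.
\<close>

lemma relators_closed: "relators R J \<subseteq> carrier (free_alg J)"
proof -
  have pow1: "(-1) ^ r * p \<in> carrier (free_alg J)" if "p \<in> carrier (free_alg J)"
    for r and p :: "('a \<Rightarrow>\<^sub>0 int, 'b) falg"
    using that by (cases "even r") simp_all
  have "serre R x p q \<in> carrier (free_alg J)"
    if "x p \<in> carrier (free_alg J)" "x q \<in> carrier (free_alg J)" for x p q
    using that by (auto simp: serre_def Let_def mult.assoc intro!: free_alg_sum_closed pow1)
  then show ?thesis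
    by (auto simp: relators_def)
qed

lemma ideal_rel_ideal: "ideal (rel_ideal R J) (free_alg J)"
  unfolding rel_ideal_def by (rule ring.genideal_ideal[OF ring_free_alg relators_closed])

lemma ring_QG: "ring (QG R J)"
  unfolding QG_def by (rule ideal.quotient_is_ring[OF ideal_rel_ideal])

lemma cls_hom: "cls R J \<in> ring_hom (free_alg J) (QG R J)"
  using ideal.rcos_ring_hom[OF ideal_rel_ideal, of J R] unfolding QG_def cls_def[abs_def] .

lemma QG_carrierE:
  assumes "x \<in> carrier (QG R J)"
  obtains p where "p \<in> carrier (free_alg J)" "x = cls R J p"
  using assms by (auto simp: QG_def FactRing_def A_RCOSETS_def' cls_def)

lemma cls_closed [simp]: "p \<in> carrier (free_alg J) \<Longrightarrow> cls R J p \<in> carrier (QG R J)"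
  using cls_hom by (rule ring_hom_closed)

text \<open>
  Equality in the quantum group, for representatives. The carrier conditions are built in, so that
  the compatibility rules below have no side conditions.
\<close>

definition qg_eq :: "('i, 'y::ab_group_add, 'x::ab_group_add) root_datum \<Rightarrow> ('i \<Rightarrow>\<^sub>0 int) set
    \<Rightarrow> ('i \<Rightarrow>\<^sub>0 int, 'y) falg \<Rightarrow> ('i \<Rightarrow>\<^sub>0 int, 'y) falg \<Rightarrow> bool" where
  "qg_eq R J p q \<longleftrightarrow> p \<in> carrier (free_alg J) \<and> q \<in> carrier (free_alg J) \<and> cls R J p = cls R J q"

lemma qg_eq_refl: "p \<in> carrier (free_alg J) \<Longrightarrow> qg_eq R J p p"
  and qg_eq_sym: "qg_eq R J p q \<Longrightarrow> qg_eq R J q p"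
  and qg_eq_trans [trans]: "qg_eq R J p q \<Longrightarrow> qg_eq R J q r \<Longrightarrow> qg_eq R J p r"
  by (simp_all add: qg_eq_def)

lemma qg_eq_add: "qg_eq R J p p' \<Longrightarrow> qg_eq R J q q' \<Longrightarrow> qg_eq R J (p + q) (p' + q')"
  and qg_eq_mult: "qg_eq R J p p' \<Longrightarrow> qg_eq R J q q' \<Longrightarrow> qg_eq R J (p * q) (p' * q')"
  using ring_hom_add[OF cls_hom[of R J]] ring_hom_mult[OF cls_hom[of R J]]
  by (auto simp: qg_eq_def)

lemma qg_eq_scal: "qg_eq R J p q \<Longrightarrow> qg_eq R J (scal c p) (scal c q)"
  unfolding scal_def by (intro qg_eq_mult qg_eq_refl) simp_all

lemma qg_eq_minus: "qg_eq R J p q \<Longrightarrow> qg_eq R J (- p) (- q)"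
  using qg_eq_scal[of R J p q "-1"] by (simp add: scal_minus_left)

lemma qg_eq_diff: "qg_eq R J p p' \<Longrightarrow> qg_eq R J q q' \<Longrightarrow> qg_eq R J (p - q) (p' - q')"
  using qg_eq_add[of R J p p' "- q" "- q'"] qg_eq_minus[of R J q q'] by simp

lemma qg_eq_relator:
  assumes "p - q \<in> relators R J" "p \<in> carrier (free_alg J)" "q \<in> carrier (free_alg J)"
  shows "qg_eq R J p q"
proof -
  have "p \<ominus>\<^bsub>free_alg J\<^esub> q \<in> rel_ideal R J"
    using assms ring.genideal_self[OF ring_free_alg relators_closed, of R J]
    by (auto simp: rel_ideal_def)
  then show ?thesis
    using assms ring.quotient_eq_iff_same_a_r_cos[OF ring_free_alg ideal_rel_ideal, of p J q R]
    by (simp add: qg_eq_def cls_def)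
qed

lemma relation_K0: "qg_eq R J (gK 0) 1"
  and relation_KK: "qg_eq R J (gK \<mu> * gK \<nu>) (gK (\<mu> + \<nu>))"
  and relation_KE: "q \<in> J \<Longrightarrow>
    qg_eq R J (gK \<mu> * gE q) (scal (v powi pairing R \<mu> (xel R q)) (gE q * gK \<mu>))"
  and relation_KF: "q \<in> J \<Longrightarrow>
    qg_eq R J (gK \<mu> * gF q) (scal (v powi (- pairing R \<mu> (xel R q))) (gF q * gK \<mu>))"
  and relation_EF_same: "q \<in> J \<Longrightarrow>
    qg_eq R J (gE q * gF q) (gF q * gE q +
      scal (inverse (vpar R q - inverse (vpar R q))) (Ktil R q 1 - Ktil R q (- 1)))"
  and relation_EF_diff: "p \<in> J \<Longrightarrow> q \<in> J \<Longrightarrow> p \<noteq> q \<Longrightarrow>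
    qg_eq R J (gE p * gF q) (gF q * gE p)"
proof -
  note [simp del] = scal_simps
  show "qg_eq R J (gK 0) 1"
    by (rule qg_eq_relator) (simp_all add: relators_def)
  show "qg_eq R J (gK \<mu> * gK \<nu>) (gK (\<mu> + \<nu>))"
    by (rule qg_eq_relator) (auto simp add: relators_def)
  show "qg_eq R J (gK \<mu> * gE q) (scal (v powi pairing R \<mu> (xel R q)) (gE q * gK \<mu>))" if "q \<in> J"
    using that
    by (intro qg_eq_relator) (auto simp add: relators_def scal_def mult.assoc)
  show "qg_eq R J (gK \<mu> * gF q) (scal (v powi (- pairing R \<mu> (xel R q))) (gF q * gK \<mu>))" if "q \<in> J"
    using that
    by (intro qg_eq_relator) (auto simp add: relators_def scal_def mult.assoc)
  show "qg_eq R J (gE p * gF q) (gF q * gE p)" if "p \<in> J" "q \<in> J" "p \<noteq> q"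
    using that by (intro qg_eq_relator) (auto simp add: relators_def)
  show "qg_eq R J (gE q * gF q) (gF q * gE q +
      scal (inverse (vpar R q - inverse (vpar R q))) (Ktil R q 1 - Ktil R q (- 1)))" if "q \<in> J"
    using that
    by (intro qg_eq_relator)
      (auto simp add: relators_def scal_def diff_diff_eq[symmetric])
qed

section \<open>Algebra homomorphisms on representatives\<close>

text \<open>
  A value of a homomorphism, recorded on representatives. The rules below compute values of products
  and composites without unfolding the quotient.
\<close>

definition sends :: "('i, 'y::ab_group_add, 'x::ab_group_add) root_datum
    \<Rightarrow> ('i \<Rightarrow>\<^sub>0 int) set \<Rightarrow> ('i \<Rightarrow>\<^sub>0 int) set
    \<Rightarrow> (('i \<Rightarrow>\<^sub>0 int, 'y) falg set \<Rightarrow> ('i \<Rightarrow>\<^sub>0 int, 'y) falg set)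
    \<Rightarrow> ('i \<Rightarrow>\<^sub>0 int, 'y) falg \<Rightarrow> ('i \<Rightarrow>\<^sub>0 int, 'y) falg \<Rightarrow> bool" where
  "sends R J J' h p p' \<longleftrightarrow>
     p \<in> carrier (free_alg J) \<and> p' \<in> carrier (free_alg J') \<and> h (cls R J p) = cls R J' p'"

lemma sends_eqD: "sends R J J' h p p' \<Longrightarrow> h (cls R J p) = cls R J' p'"
  by (simp add: sends_def)

lemma sends_cong: "sends R J J' h p p' \<Longrightarrow> qg_eq R J' p' p'' \<Longrightarrow> sends R J J' h p p''"
  by (simp add: sends_def qg_eq_def)

lemma sends_comp: "sends R J J' h p p' \<Longrightarrow> sends R J' J'' g p' p'' \<Longrightarrow> sends R J J'' (g \<circ> h) p p''"
  by (simp add: sends_def)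

lemma sends_id: "p \<in> carrier (free_alg J) \<Longrightarrow> sends R J J id p p"
  by (simp add: sends_def)

lemma alg_hom_ring_hom: "h \<in> alg_hom R J J' \<Longrightarrow> h \<in> ring_hom (QG R J) (QG R J')"
  by (simp add: alg_hom_def)

lemma sends_const: "h \<in> alg_hom R J J' \<Longrightarrow> sends R J J' h (const c) (const c)"
  by (simp add: alg_hom_def sends_def)

lemma sends_add:
  assumes "h \<in> alg_hom R J J'" "sends R J J' h p p'" "sends R J J' h q q'"
  shows "sends R J J' h (p + q) (p' + q')"
  using assms ring_hom_add[OF cls_hom[of R J], of p q] ring_hom_add[OF cls_hom[of R J'], of p' q']
    ring_hom_add[OF alg_hom_ring_hom[OF assms(1)], of "cls R J p" "cls R J q"]
  by (simp add: sends_def)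

lemma sends_mult:
  assumes "h \<in> alg_hom R J J'" "sends R J J' h p p'" "sends R J J' h q q'"
  shows "sends R J J' h (p * q) (p' * q')"
  using assms ring_hom_mult[OF cls_hom[of R J], of p q] ring_hom_mult[OF cls_hom[of R J'], of p' q']
    ring_hom_mult[OF alg_hom_ring_hom[OF assms(1)], of "cls R J p" "cls R J q"]
  by (simp add: sends_def)

lemma sends_scal: "h \<in> alg_hom R J J' \<Longrightarrow> sends R J J' h p p' \<Longrightarrow> sends R J J' h (scal c p) (scal c p')"
  unfolding scal_def by (intro sends_mult sends_const)

lemma sends_diff:
  assumes "h \<in> alg_hom R J J'" "sends R J J' h p p'" "sends R J J' h q q'"
  shows "sends R J J' h (p - q) (p' - q')"
  using sends_add[OF assms(1,2) sends_scal[OF assms(1,3), of "-1"]] by (simp add: scal_minus_left)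

lemma alg_hom_unique:
  assumes g: "g \<in> alg_hom R J J'" and h: "h \<in> alg_hom R J J'"
    and E: "\<And>q. q \<in> J \<Longrightarrow> g (cls R J (gE q)) = h (cls R J (gE q))"
    and F: "\<And>q. q \<in> J \<Longrightarrow> g (cls R J (gF q)) = h (cls R J (gF q))"
    and K: "\<And>\<mu>. g (cls R J (gK \<mu>)) = h (cls R J (gK \<mu>))"
    and x: "x \<in> carrier (QG R J)"
  shows "g x = h x"
proof -
  obtain p where p: "p \<in> carrier (free_alg J)" and xp: "x = cls R J p"
    using x by (rule QG_carrierE)
  from p have "g (cls R J p) = h (cls R J p)"
  proof (induction rule: free_alg_induct)
    case (const c)
    then show ?case using g h by (simp add: alg_hom_def)
  next
    case (add p q)
    then show ?case
      using ring_hom_add[OF cls_hom[of R J], of p q]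
        ring_hom_add[OF alg_hom_ring_hom[OF g], of "cls R J p" "cls R J q"]
        ring_hom_add[OF alg_hom_ring_hom[OF h], of "cls R J p" "cls R J q"] by simp
  next
    case (mult p q)
    then show ?case
      using ring_hom_mult[OF cls_hom[of R J], of p q]
        ring_hom_mult[OF alg_hom_ring_hom[OF g], of "cls R J p" "cls R J q"]
        ring_hom_mult[OF alg_hom_ring_hom[OF h], of "cls R J p" "cls R J q"] by simp
  qed (simp_all add: E F K)
  then show ?thesis by (simp add: xp)
qed

lemma alg_hom_id: "id \<in> alg_hom R J J"
  by (simp add: alg_hom_def id_ring_hom)

lemma alg_hom_comp: "h \<in> alg_hom R J J' \<Longrightarrow> g \<in> alg_hom R J' J'' \<Longrightarrow> g \<circ> h \<in> alg_hom R J J''"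
  unfolding alg_hom_def using ring_hom_trans[of h "QG R J" "QG R J'" g "QG R J''"] by auto

lemma alg_hom_inv_into:
  assumes h: "h \<in> alg_hom R J J'" and bij: "bij_betw h (carrier (QG R J)) (carrier (QG R J'))"
  shows "inv_into (carrier (QG R J)) h \<in> alg_hom R J' J"
proof -
  have "inv_into (carrier (QG R J)) h \<in> ring_hom (QG R J') (QG R J)"
    using ring_iso_set_sym[OF ring_QG, of h R J "QG R J'"] h bij
    by (auto simp: ring_iso_def alg_hom_def)
  moreover have "inv_into (carrier (QG R J)) h (cls R J' (const c)) = cls R J (const c)" for c
    using h bij by (intro inv_into_f_eq) (auto simp: bij_betw_def alg_hom_def)
  ultimately show ?thesis by (simp add: alg_hom_def)
qed

lemma sends_inv_into:
  assumes "bij_betw h (carrier (QG R J)) (carrier (QG R J'))" "sends R J J' h p p'"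
  shows "sends R J' J (inv_into (carrier (QG R J)) h) p' p"
  using assms inv_into_f_eq[of h "carrier (QG R J)" "cls R J p" "cls R J' p'"]
  by (auto simp: sends_def bij_betw_def)


section \<open>The rank two computation\<close>

text \<open>
  With \<open>B = G E - u E G\<close>, the left-hand side is \<open>A B - u B A\<close> for \<open>A = - K F\<close>. Moving \<open>K\<close> to the left past
  \<open>B\<close> costs a factor \<open>u\<inverse>\<close>, which turns the expression into \<open>K (B F - F B)\<close>. Since \<open>F\<close> commutes with
  \<open>G\<close>, the inner commutator equals \<open>G H - u H G\<close> with \<open>H = E F - F E = c (K - K')\<close>. The \<open>K\<close>-part of \<open>H\<close>
  cancels because \<open>G K = u K G\<close>, the other part leaves \<open>c (u - u\<inverse>) K' G = K' G\<close>, and \<open>K K' = 1\<close>.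

  The product is a parameter that may be the opposite one: the relations of a quantum group are
  stable under the exchange of \<open>E\<close> and \<open>F\<close> combined with the reversal of products and the replacement
  of \<open>u\<close> and \<open>K\<close> by their inverses. So the statement covers the images of \<open>E\<close> and of \<open>F\<close> alike.
\<close>

lemma rank_two_cancellation:
  fixes m :: "('i \<Rightarrow>\<^sub>0 int, 'y::ab_group_add) falg \<Rightarrow> _ \<Rightarrow> _"  (infixl "\<odot>" 70)
    and R :: "('i, 'y, 'x::ab_group_add) root_datum"
  assumes m: "(\<forall>p q. p \<odot> q = p * q) \<or> (\<forall>p q. p \<odot> q = q * p)"
    and EF: "qg_eq R J (E \<odot> F) (F \<odot> E + scal c (K - K'))"
    and GF: "qg_eq R J (G \<odot> F) (F \<odot> G)"
    and GK: "qg_eq R J (G \<odot> K) (scal u (K \<odot> G))"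
    and GK': "qg_eq R J (G \<odot> K') (scal (inverse u) (K' \<odot> G))"
    and EK: "qg_eq R J (E \<odot> K) (scal (inverse u * inverse u) (K \<odot> E))"
    and KK': "qg_eq R J (K \<odot> K') 1"
    and c: "c * (u - inverse u) = 1" and u: "u \<noteq> 0"
    and closed: "E \<in> carrier (free_alg J)" "F \<in> carrier (free_alg J)" "G \<in> carrier (free_alg J)"
      "K \<in> carrier (free_alg J)" "K' \<in> carrier (free_alg J)"
    and B: "B = G \<odot> E - scal u (E \<odot> G)"
  shows "qg_eq R J (scal u (B \<odot> (K \<odot> F)) - K \<odot> F \<odot> B) G"
proof -
  have ring: "p \<odot> q \<odot> r = p \<odot> (q \<odot> r)"
    "(p + q) \<odot> r = p \<odot> r + q \<odot> r" "r \<odot> (p + q) = r \<odot> p + r \<odot> q"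
    "(p - q) \<odot> r = p \<odot> r - q \<odot> r" "r \<odot> (p - q) = r \<odot> p - r \<odot> q"
    "scal a p \<odot> q = scal a (p \<odot> q)" "p \<odot> scal a q = scal a (p \<odot> q)" "1 \<odot> p = p" for p q r a
    using m by (auto simp: algebra_simps)
  have mult: "qg_eq R J (p \<odot> q) (p' \<odot> q')" if "qg_eq R J p p'" "qg_eq R J q q'" for p p' q q'
    using m that by (auto intro: qg_eq_mult)
  have prod_closed: "p \<odot> q \<in> carrier (free_alg J)"
    if "p \<in> carrier (free_alg J)" "q \<in> carrier (free_alg J)" for p q
    using m that by auto
  note closed = closed prod_closed
  note left = mult[OF qg_eq_refl] and right = mult[OF _ qg_eq_refl]
  have B_closed: "B \<in> carrier (free_alg J)" by (simp add: B closed)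
  have GEK: "qg_eq R J (G \<odot> E \<odot> K) (scal (inverse u) (K \<odot> (G \<odot> E)))"
  proof -
    have "qg_eq R J (G \<odot> (E \<odot> K)) (G \<odot> scal (inverse u * inverse u) (K \<odot> E))"
      by (intro left EK closed)
    also have "G \<odot> scal (inverse u * inverse u) (K \<odot> E) = scal (inverse u * inverse u) (G \<odot> K \<odot> E)"
      by (simp add: ring)
    also have "qg_eq R J \<dots> (scal (inverse u * inverse u) (scal u (K \<odot> G) \<odot> E))"
      by (intro qg_eq_scal right GK closed)
    also have "\<dots> = scal (inverse u) (K \<odot> (G \<odot> E))"
      using u by (simp add: ring mult.assoc)
    finally show ?thesis by (simp add: ring)
  qed
  have EGK: "qg_eq R J (E \<odot> G \<odot> K) (scal (inverse u) (K \<odot> (E \<odot> G)))"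
  proof -
    have "qg_eq R J (E \<odot> (G \<odot> K)) (E \<odot> scal u (K \<odot> G))"
      by (intro left GK closed)
    also have "E \<odot> scal u (K \<odot> G) = scal u (E \<odot> K \<odot> G)"
      by (simp add: ring)
    also have "qg_eq R J \<dots> (scal u (scal (inverse u * inverse u) (K \<odot> E) \<odot> G))"
      by (intro qg_eq_scal right EK closed)
    also have "\<dots> = scal (inverse u) (K \<odot> (E \<odot> G))"
      using u by (simp add: ring flip: mult.assoc)
    finally show ?thesis by (simp add: ring)
  qed
  have BK: "qg_eq R J (scal u (B \<odot> K)) (K \<odot> B)"
  proof -
    have "scal u (B \<odot> K) = scal u (G \<odot> E \<odot> K - scal u (E \<odot> G \<odot> K))"
      by (simp add: B ring)
    also have "qg_eq R J \<dots> (scal u (scal (inverse u) (K \<odot> (G \<odot> E))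
        - scal u (scal (inverse u) (K \<odot> (E \<odot> G)))))"
      by (intro qg_eq_scal qg_eq_diff GEK EGK)
    also have "\<dots> = K \<odot> B"
      using u by (simp add: B ring)
    finally show ?thesis .
  qed
  \<comment> \<open>\<open>H\<close> stands for the commutator of \<open>E\<close> and \<open>F\<close>.\<close>
  define H where "H = scal c (K - K')"
  have H_closed: "H \<in> carrier (free_alg J)" by (simp add: H_def closed)
  have GH: "qg_eq R J (G \<odot> H - scal u (H \<odot> G)) (K' \<odot> G)"
  proof -
    have "G \<odot> H - scal u (H \<odot> G)
        = scal c (G \<odot> K - G \<odot> K') - scal (c * u) (K \<odot> G) + scal (c * u) (K' \<odot> G)"
      by (simp add: H_def ring mult.commute)
    also have "qg_eq R J \<dots> (scal c (scal u (K \<odot> G) - scal (inverse u) (K' \<odot> G))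
        - scal (c * u) (K \<odot> G) + scal (c * u) (K' \<odot> G))"
      by (intro qg_eq_add qg_eq_diff qg_eq_scal GK GK' qg_eq_refl free_alg_closed_derived closed)
    also have "\<dots> = scal (c * (u - inverse u)) (K' \<odot> G)"
      unfolding right_diff_distrib scal_diff_left by simp
    finally show ?thesis by (simp add: c)
  qed
  have BF: "qg_eq R J (B \<odot> F) (F \<odot> B + K' \<odot> G)"
  proof -
    have EF': "qg_eq R J (E \<odot> F) (F \<odot> E + H)" using EF by (simp add: H_def)
    have "qg_eq R J (G \<odot> (E \<odot> F)) (G \<odot> (F \<odot> E + H))"
      by (intro left EF' closed)
    also have "G \<odot> (F \<odot> E + H) = G \<odot> F \<odot> E + G \<odot> H"
      by (simp add: ring)
    also have "qg_eq R J \<dots> (F \<odot> G \<odot> E + G \<odot> H)"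
      by (intro qg_eq_add right GF qg_eq_refl closed H_closed)
    finally have 1: "qg_eq R J (G \<odot> (E \<odot> F)) (F \<odot> G \<odot> E + G \<odot> H)" .
    have "qg_eq R J (E \<odot> (G \<odot> F)) (E \<odot> (F \<odot> G))"
      by (intro left GF closed)
    also have "E \<odot> (F \<odot> G) = E \<odot> F \<odot> G"
      by (simp add: ring)
    also have "qg_eq R J \<dots> ((F \<odot> E + H) \<odot> G)"
      by (intro right EF' closed)
    finally have 2: "qg_eq R J (E \<odot> (G \<odot> F)) ((F \<odot> E + H) \<odot> G)" .
    have "B \<odot> F = G \<odot> (E \<odot> F) - scal u (E \<odot> (G \<odot> F))"
      by (simp add: B ring)
    also have "qg_eq R J \<dots> ((F \<odot> G \<odot> E + G \<odot> H) - scal u ((F \<odot> E + H) \<odot> G))"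
      by (intro qg_eq_diff qg_eq_scal 1 2)
    also have "\<dots> = F \<odot> B + (G \<odot> H - scal u (H \<odot> G))"
      by (simp add: B ring)
    also have "qg_eq R J \<dots> (F \<odot> B + K' \<odot> G)"
      by (intro qg_eq_add GH qg_eq_refl closed B_closed)
    finally show ?thesis .
  qed
  have "scal u (B \<odot> (K \<odot> F)) - K \<odot> F \<odot> B = scal u (B \<odot> K) \<odot> F - K \<odot> F \<odot> B"
    by (simp add: ring)
  also have "qg_eq R J \<dots> (K \<odot> B \<odot> F - K \<odot> F \<odot> B)"
    by (intro qg_eq_diff right BK qg_eq_refl closed B_closed)
  also have "K \<odot> B \<odot> F - K \<odot> F \<odot> B = K \<odot> (B \<odot> F) - K \<odot> F \<odot> B"
    by (simp add: ring)
  also have "qg_eq R J \<dots> (K \<odot> (F \<odot> B + K' \<odot> G) - K \<odot> F \<odot> B)"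
    by (intro qg_eq_diff left BF qg_eq_refl closed B_closed)
  also have "\<dots> = K \<odot> K' \<odot> G"
    by (simp add: ring)
  also have "qg_eq R J \<dots> (1 \<odot> G)"
    by (intro right KK' closed)
  finally show ?thesis by (simp add: ring)
qed

section \<open>Root data and reflections\<close>

lemma zscale_one [simp]: "zscale 1 x = x" and zscale_zero [simp]: "zscale 0 x = 0"
  by (simp_all add: zscale_def)

lemma zscale_minus: "zscale (- n) x = - zscale n x"
  by (simp add: zscale_def)

lemma yel_frag_of [simp]: "yel R (frag_of i) = ydir R i"
  and xel_frag_of [simp]: "xel R (frag_of i) = xdir R i"
  by (simp_all add: yel_def xel_def)

lemma pairing_zscale:
  assumes "is_root_datum R"
  shows "pairing R (zscale n \<mu>) \<xi> = n * pairing R \<mu> \<xi>"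
proof -
  interpret additive "\<lambda>\<mu>. pairing R \<mu> \<xi>"
    using assms by (simp add: is_root_datum_def perfect_pairing_def)
  show ?thesis by (simp add: zscale_def sum minus)
qed

lemma form_pos:
  assumes "is_root_datum R" "i \<in> simples R"
  shows "form R (frag_of i) (frag_of i) > 0" "form R (frag_of i) (frag_of i) div 2 > 0"
proof -
  show "form R (frag_of i) (frag_of i) > 0"
    using assms by (simp add: is_root_datum_def cartan_datum_def)
  moreover have "even (form R (frag_of i) (frag_of i))"
    using assms by (simp add: is_root_datum_def cartan_datum_def)
  ultimately show "form R (frag_of i) (frag_of i) div 2 > 0"
    by (elim evenE) simp
qed

lemma pairing_form:
  assumes "is_root_datum R" "i \<in> simples R" "j \<in> simples R"
  shows "pairing R (ydir R i) (xdir R j) * form R (frag_of i) (frag_of i) = 2 * form R (frag_of i) (frag_of j)"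
  using assms by (simp add: is_root_datum_def)

lemma form_commute:
  assumes "is_root_datum R" "i \<in> simples R" "j \<in> simples R"
  shows "form R (frag_of i) (frag_of j) = form R (frag_of j) (frag_of i)"
  using assms by (simp add: is_root_datum_def cartan_datum_def)

lemma form_add_right:
  assumes "is_root_datum R" "i \<in> simples R" "j \<in> simples R" "k \<in> simples R"
  shows "form R (frag_of i) (frag_of j + frag_of k)
    = form R (frag_of i) (frag_of j) + form R (frag_of i) (frag_of k)"
proof -
  have B: "cartan_datum (simples R) (form R)"
    using assms by (simp add: is_root_datum_def)
  have "frag_of i \<in> lattice (simples R)" "frag_of j \<in> lattice (simples R)"
    "frag_of k \<in> lattice (simples R)" "frag_of j + frag_of k \<in> lattice (simples R)"
    using assms keys_add[of "frag_of j" "frag_of k"] by auto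
  then show ?thesis
    using B unfolding cartan_datum_def by metis
qed

lemma pairing_self:
  assumes "is_root_datum R" "i \<in> simples R"
  shows "pairing R (ydir R i) (xdir R i) = 2"
  using pairing_form[OF assms assms(2)] form_pos(1)[OF assms] by simp

lemma refl_Y_involution:
  assumes R: "is_root_datum R" and i: "i \<in> simples R"
  shows "refl_Y R i (refl_Y R i \<mu>) = \<mu>"
proof -
  interpret additive "\<lambda>\<mu>. pairing R \<mu> (xdir R i)"
    using R by (simp add: is_root_datum_def perfect_pairing_def)
  show ?thesis
    by (simp add: refl_Y_def diff pairing_zscale[OF R] pairing_self[OF R i] zscale_minus)
qed

text \<open>
  A simply laced edge of the Cartan datum.
\<close>

definition edge :: "('i, 'y, 'x) root_datum \<Rightarrow> 'i \<Rightarrow> 'i \<Rightarrow> bool" where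
  "edge R i j \<longleftrightarrow> i \<in> simples R \<and> j \<in> simples R \<and> i \<noteq> j \<and>
     form R (frag_of i) (frag_of i) = form R (frag_of j) (frag_of j) \<and>
     form R (frag_of j) (frag_of j) = - 2 * form R (frag_of i) (frag_of j)"

lemma edge_sym: "is_root_datum R \<Longrightarrow> edge R i j \<Longrightarrow> edge R j i"
  using form_commute[of R i j] by (auto simp: edge_def)

lemma edge_form:
  assumes "edge R i j"
  shows "2 * form R (frag_of i) (frag_of j) = - form R (frag_of i) (frag_of i)"
  using assms by (simp add: edge_def)

lemma edge_pairing:
  assumes R: "is_root_datum R" and e: "edge R i j"
  shows "pairing R (ydir R i) (xdir R j) = - 1"
proof -
  have i: "i \<in> simples R" and j: "j \<in> simples R"
    using e by (simp_all add: edge_def)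
  have "pairing R (ydir R i) (xdir R j) * form R (frag_of i) (frag_of i)
      = (- 1) * form R (frag_of i) (frag_of i)"
    unfolding pairing_form[OF R i j] edge_form[OF e] by simp
  then show ?thesis
    using form_pos(1)[OF R i] by (metis mult_cancel_right less_irrefl)
qed

lemma edge_vpar: "edge R i j \<Longrightarrow> vpar R (frag_of i) = vpar R (frag_of j)"
  by (simp add: edge_def vpar_def)

lemma orthogonal_pairing:
  assumes R: "is_root_datum R" and "i \<in> simples R" "j \<in> simples R" "form R (frag_of i) (frag_of j) = 0"
  shows "pairing R (ydir R i) (xdir R j) = 0"
  using pairing_form[OF assms(1-3)] form_pos(1)[OF assms(1,2)] assms(4) by auto

lemma refl_L_orthogonal: "form R (frag_of i) q = 0 \<Longrightarrow> refl_L R i q = q"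
  by (simp add: refl_L_def)

text \<open>
  The quotient in \<open>refl_L\<close> is \<open>- 1\<close> on \<open>j\<close> and hence \<open>2 - 1 = 1\<close> on \<open>i + j\<close>.
\<close>

lemma refl_L_edge:
  assumes R: "is_root_datum R" and e: "edge R i j"
  shows "refl_L R i (frag_of j) = frag_of i + frag_of j"
    and "refl_L R i (frag_of i + frag_of j) = frag_of j"
proof -
  have i: "i \<in> simples R" and j: "j \<in> simples R"
    using e by (simp_all add: edge_def)
  define b where "b = form R (frag_of i) (frag_of i)"
  have b: "b > 0"
    using form_pos(1)[OF R i] by (simp add: b_def)
  have j1: "2 * form R (frag_of i) (frag_of j) = (- 1) * b"
    using edge_form[OF e] by (simp add: b_def)
  then have ij1: "2 * form R (frag_of i) (frag_of i + frag_of j) = 1 * b"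
    using form_add_right[OF R i i j] by (simp add: b_def)
  have div: "(a * b) div b = a" for a
    using b by simp
  show "refl_L R i (frag_of j) = frag_of i + frag_of j"
    unfolding refl_L_def j1 b_def[symmetric] div by simp
  show "refl_L R i (frag_of i + frag_of j) = frag_of j"
    unfolding refl_L_def ij1 b_def[symmetric] div by simp
qed

lemma v_power: "v ^ n = Fract ([:0, 1:] ^ n) 1"
  by (induction n) (simp_all add: v_def One_fract_def)

lemma v_power_neq_1: "n > 0 \<Longrightarrow> v ^ n \<noteq> 1"
proof
  assume n: "n > 0" and "v ^ n = 1"
  then have "[:0, 1 :: rat:] ^ n = 1"
    by (simp add: v_power One_fract_def eq_fract)
  then have "degree ([:0, 1 :: rat:] ^ n) = 0" by simp
  then show False
    using n by (simp add: degree_power_eq)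
qed

lemma v_neq_0: "v \<noteq> 0"
  using v_power_neq_1[of 1] by (simp add: v_def Zero_fract_def eq_fract)

text \<open>
  This is what makes \<open>[1]\<^sub>i = 1\<close>: the parameter \<open>v\<^sub>i\<close> is a positive power of the indeterminate, so its
  square is not \<open>1\<close> and the quotient defining \<open>[n]\<^sub>i\<close> has a nonzero denominator.
\<close>

lemma vpar_neq:
  assumes "is_root_datum R" "i \<in> simples R"
  shows "vpar R (frag_of i) \<noteq> 0" "vpar R (frag_of i) - inverse (vpar R (frag_of i)) \<noteq> 0"
proof -
  let ?d = "form R (frag_of i) (frag_of i) div 2"
  show nz: "vpar R (frag_of i) \<noteq> 0"
    by (simp add: vpar_def v_neq_0)
  have "vpar R (frag_of i) * vpar R (frag_of i) = v ^ (2 * nat ?d)"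
    using form_pos(2)[OF assms] by (simp add: vpar_def power_int_nonneg_exp mult_2 flip: power_add)
  also have "\<dots> \<noteq> 1"
    using form_pos(2)[OF assms] by (intro v_power_neq_1) simp
  finally show "vpar R (frag_of i) - inverse (vpar R (frag_of i)) \<noteq> 0"
    using nz by (metis eq_iff_diff_eq_0 right_inverse)
qed

section \<open>Braid operators on rank two subdiagrams\<close>

lemma dpow_0: "dpow w p 0 = p ^ 0"
  by (simp add: dpow_def qfact_def)

lemma dpow_1: "w - inverse w \<noteq> 0 \<Longrightarrow> dpow w p (Suc 0) = p"
  by (simp add: dpow_def qfact_def qint_def)

lemma braid_alg_hom: "is_braid R i e T \<Longrightarrow> T \<in> alg_hom R (idx R) (idx R)"
  by (simp add: is_braid_def Let_def)

lemma braid_K: "is_braid R i e T \<Longrightarrow> sends R (idx R) (idx R) T (gK \<mu>) (gK (refl_Y R i \<mu>))"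
  by (simp add: is_braid_def Let_def sends_def)

lemma braid_same:
  assumes "is_braid R i e T" "i \<in> simples R"
  shows "sends R (idx R) (idx R) T (gE (frag_of i)) (- (Ktil R (frag_of i) e * gF (frag_of i)))"
    "sends R (idx R) (idx R) T (gF (frag_of i)) (- (gE (frag_of i) * Ktil R (frag_of i) (- e)))"
  using assms by (simp_all add: is_braid_def Let_def sends_def)

text \<open>
  For orthogonal vertices the sum in the definition of the braid operator has only the term with
  \<open>r = s = 0\<close>.
\<close>

lemma braid_orthogonal:
  assumes "is_root_datum R" and "is_braid R i e T" and "i \<in> simples R" "j \<in> simples R - {i}"
    and "form R (frag_of i) (frag_of j) = 0"
  shows "sends R (idx R) (idx R) T (gE (frag_of j)) (gE (frag_of j))"
    "sends R (idx R) (idx R) T (gF (frag_of j)) (gF (frag_of j))"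
  using assms orthogonal_pairing[of R i j]
  by (auto simp: is_braid_def Let_def sends_def dpow_0)

text \<open>
  Along a simply laced edge \<open>\<langle>i, j'\<rangle> = - 1\<close>, so the sum has the two terms \<open>r = 0\<close> and \<open>r = 1\<close>.
\<close>

lemma braid_edge:
  assumes R: "is_root_datum R" and T: "is_braid R i e T" and ij: "edge R i j"
  defines "u \<equiv> vpar R (frag_of i) powi e"
  shows "sends R (idx R) (idx R) T (gE (frag_of j))
      (gE (frag_of j) * gE (frag_of i) - scal u (gE (frag_of i) * gE (frag_of j)))" (is ?E)
    and "sends R (idx R) (idx R) T (gF (frag_of j))
      (gF (frag_of i) * gF (frag_of j) - scal (inverse u) (gF (frag_of j) * gF (frag_of i)))" (is ?F)
proof -
  have mem: "i \<in> simples R" "j \<in> simples R - {i}" using ij by (auto simp: edge_def)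
  note w = vpar_neq[OF R mem(1)]
  have neg: "const (- c) * p * q = - scal c (p * q)" for c and p q :: "('a \<Rightarrow>\<^sub>0 int, 'b) falg"
    by (simp add: const_mult_eq_scal scal_minus_left)
  show ?E ?F
    using T mem edge_pairing[OF R ij] w
    unfolding is_braid_def Let_def sends_def u_def
    by (simp_all add: dpow_0 dpow_1 neg power_int_minus)
qed

lemma Ktil_inverse: "qg_eq R J (Ktil R q e * Ktil R q (- e)) 1"
proof -
  define \<mu> where "\<mu> = zscale (e * (form R q q div 2)) (yel R q)"
  have "Ktil R q e = gK \<mu>" "Ktil R q (- e) = gK (- \<mu>)"
    by (simp_all add: Ktil_def \<mu>_def zscale_minus)
  then show ?thesis
    using qg_eq_trans[OF relation_KK[of R J \<mu> "- \<mu>"]] relation_K0[of R J]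
    by (simp only: right_minus)
qed

lemma Ktil_commute:
  fixes R :: "('i, 'y::ab_group_add, 'x::ab_group_add) root_datum" and i j :: 'i and e :: int
  assumes R: "is_root_datum R" and j: "j \<in> simples R"
  defines "c \<equiv> v powi (e * (form R (frag_of i) (frag_of i) div 2) * pairing R (ydir R i) (xdir R j))"
  shows "qg_eq R (idx R) (gE (frag_of j) * Ktil R (frag_of i) e)
      (scal (inverse c) (Ktil R (frag_of i) e * gE (frag_of j)))"
    and "qg_eq R (idx R) (Ktil R (frag_of i) e * gF (frag_of j))
      (scal (inverse c) (gF (frag_of j) * Ktil R (frag_of i) e))"
proof -
  let ?\<mu> = "zscale (e * (form R (frag_of i) (frag_of i) div 2)) (ydir R i)"
  have K: "Ktil R (frag_of i) e = gK ?\<mu>" by (simp add: Ktil_def)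
  have c: "v powi pairing R ?\<mu> (xdir R j) = c" "c \<noteq> 0"
    using v_neq_0 by (simp_all add: c_def pairing_zscale[OF R])
  have "qg_eq R (idx R) (gK ?\<mu> * gE (frag_of j)) (scal c (gE (frag_of j) * gK ?\<mu>))"
    using relation_KE[of "frag_of j" "idx R" R ?\<mu>] j c by simp
  from qg_eq_sym[OF qg_eq_scal[OF this, of "inverse c"]]
  show "qg_eq R (idx R) (gE (frag_of j) * Ktil R (frag_of i) e)
      (scal (inverse c) (Ktil R (frag_of i) e * gE (frag_of j)))"
    using c by (simp add: K)
  show "qg_eq R (idx R) (Ktil R (frag_of i) e * gF (frag_of j))
      (scal (inverse c) (gF (frag_of j) * Ktil R (frag_of i) e))"
    using relation_KF[of "frag_of j" "idx R" R ?\<mu>] j c by (simp add: K power_int_minus)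
qed

text \<open>
  The commutator of \<open>E\<^sub>i\<close> and \<open>F\<^sub>i\<close> does not change when \<open>v\<^sub>i\<close> and the torus element are both replaced
  by their inverses: numerator and denominator change sign together. This allows the two
  signs \<open>e\<close> to be treated at once.
\<close>

lemma relation_EF_signed:
  assumes "i \<in> simples R" "e \<in> {1, - 1}"
  defines "u \<equiv> vpar R (frag_of i) powi e"
  shows "qg_eq R (idx R) (gE (frag_of i) * gF (frag_of i)) (gF (frag_of i) * gE (frag_of i)
    + scal (inverse (u - inverse u)) (Ktil R (frag_of i) e - Ktil R (frag_of i) (- e)))"
proof (cases "e = 1")
  case True
  then show ?thesis
    using relation_EF_same[of "frag_of i" "idx R" R] assms by simp
next
  case False
  then have e: "e = - 1" using assms by simp
  define w where "w = vpar R (frag_of i)"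
  have "u - inverse u = - (w - inverse w)"
    by (simp add: u_def e w_def power_int_minus)
  then have "inverse (u - inverse u) = - inverse (w - inverse w)"
    by (simp only: inverse_minus_eq)
  then have "scal (inverse (u - inverse u)) (Ktil R (frag_of i) e - Ktil R (frag_of i) (- e))
      = scal (inverse (w - inverse w)) (Ktil R (frag_of i) 1 - Ktil R (frag_of i) (- 1))"
    by (simp add: e scal_minus_left)
  then show ?thesis
    using relation_EF_same[of "frag_of i" "idx R" R] assms(1) by (simp add: w_def)
qed

text \<open>
  The operator \<open>T\<^sub>j\<close> turns \<open>E\<^sub>i\<close> into a \<open>u\<close>-commutator of \<open>E\<^sub>i\<close> and \<open>E\<^sub>j\<close>, where \<open>u = v\<^sub>i\<^sup>e\<close>, and \<open>T\<^sub>i\<close> turns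
  this into a \<open>u\<close>-commutator of \<open>- K F\<^sub>i\<close> with \<open>B = E\<^sub>j E\<^sub>i - u E\<^sub>i E\<^sub>j\<close>, to which
  \<open>rank_two_cancellation\<close> applies. For \<open>F\<^sub>i\<close> the same lemma is used with the opposite product and with
  \<open>u\<inverse>\<close> in place of \<open>u\<close>.
\<close>

lemma braid_braid_edge:
  fixes R :: "('i, 'y::ab_group_add, 'x::ab_group_add) root_datum"
  assumes R: "is_root_datum R" and ij: "edge R i j" and e: "e \<in> {1, - 1}"
    and Ti: "is_braid R i e Ti" and Tj: "is_braid R j e Tj"
  shows "sends R (idx R) (idx R) (Ti \<circ> Tj) (gE (frag_of i)) (gE (frag_of j))"
    and "sends R (idx R) (idx R) (Ti \<circ> Tj) (gF (frag_of i)) (gF (frag_of j))"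
proof -
  have i: "i \<in> simples R" and j: "j \<in> simples R" and neq: "i \<noteq> j"
    using ij by (simp_all add: edge_def)
  let ?d = "form R (frag_of i) (frag_of i) div 2"
  let ?Ei = "gE (frag_of i)" and ?Ej = "gE (frag_of j)" and ?Fi = "gF (frag_of i)" and ?Fj = "gF (frag_of j)"
  let ?K = "Ktil R (frag_of i)"
  define u where "u = vpar R (frag_of i) powi e"
  have u: "u = v powi (e * ?d)"
    by (simp add: u_def vpar_def mult.commute flip: power_int_mult)
  have u0: "u \<noteq> 0" using v_neq_0 by (simp add: u)
  have uu: "u - inverse u \<noteq> 0"
    using vpar_neq(2)[OF R i] e by (auto simp: u_def power_int_minus)
  have cu: "inverse (u - inverse u) * (u - inverse u) = 1"
    "inverse (inverse u - u) * (inverse u - u) = 1"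
    using uu by (simp_all add: field_simps)
  have sq: "v powi (e * ?d * 2) = u * u"
    unfolding u mult_2_right by (rule power_int_add) (simp add: v_neq_0)
  have sq': "v powi (- (e * ?d * 2)) = inverse u * inverse u"
    unfolding power_int_minus sq by simp
  note self = pairing_self[OF R i] and adj = edge_pairing[OF R ij]
  note Ei = sends_mult[OF braid_alg_hom[OF Ti]] and Di = sends_diff[OF braid_alg_hom[OF Ti]]
    and Si = sends_scal[OF braid_alg_hom[OF Ti]]
  note Ti_i = braid_same[OF Ti i] and Ti_j = braid_edge[OF R Ti ij, folded u_def]
  have Tj_i: "sends R (idx R) (idx R) Tj ?Ei (?Ei * ?Ej - scal u (?Ej * ?Ei))"
    "sends R (idx R) (idx R) Tj ?Fi (?Fj * ?Fi - scal (inverse u) (?Fi * ?Fj))"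
    using braid_edge[OF R Tj edge_sym[OF R ij]] by (simp_all add: u_def edge_vpar[OF ij])

  define B :: "('i \<Rightarrow>\<^sub>0 int, 'y) falg" where "B = ?Ej * ?Ei - scal u (?Ei * ?Ej)"
  have "sends R (idx R) (idx R) Ti (?Ei * ?Ej - scal u (?Ej * ?Ei))
      (- (?K e * ?Fi) * B - scal u (B * - (?K e * ?Fi)))"
    unfolding B_def by (intro Di Ei Si Ti_i Ti_j)
  then have "sends R (idx R) (idx R) Ti (?Ei * ?Ej - scal u (?Ej * ?Ei))
      (scal u (B * (?K e * ?Fi)) - ?K e * ?Fi * B)"
    by simp
  moreover have "qg_eq R (idx R) (scal u (B * (?K e * ?Fi)) - ?K e * ?Fi * B) ?Ej"
  proof (rule rank_two_cancellation[where m = "(*)" and K' = "?K (- e)" and E = ?Ei])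
    show "qg_eq R (idx R) (?Ei * ?Fi) (?Fi * ?Ei + scal (inverse (u - inverse u)) (?K e - ?K (- e)))"
      unfolding u_def by (rule relation_EF_signed[OF i e])
    show "qg_eq R (idx R) (?Ej * ?Fi) (?Fi * ?Ej)"
      by (rule relation_EF_diff) (use i j neq in \<open>auto simp: frag_of_eq\<close>)
    show "qg_eq R (idx R) (?Ej * ?K e) (scal u (?K e * ?Ej))"
      using Ktil_commute(1)[OF R j, of i e] by (simp add: adj u power_int_minus)
    show "qg_eq R (idx R) (?Ej * ?K (- e)) (scal (inverse u) (?K (- e) * ?Ej))"
      using Ktil_commute(1)[OF R j, of i "- e"] by (simp add: adj u)
    show "qg_eq R (idx R) (?Ei * ?K e) (scal (inverse u * inverse u) (?K e * ?Ei))"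
      using Ktil_commute(1)[OF R i, of i e] by (simp add: self sq)
  qed (use i j u0 cu Ktil_inverse in \<open>simp_all add: B_def\<close>)
  ultimately have "sends R (idx R) (idx R) Ti (?Ei * ?Ej - scal u (?Ej * ?Ei)) ?Ej"
    by (rule sends_cong)
  with Tj_i(1) show "sends R (idx R) (idx R) (Ti \<circ> Tj) ?Ei ?Ej"
    by (rule sends_comp)

  define C :: "('i \<Rightarrow>\<^sub>0 int, 'y) falg" where "C = ?Fi * ?Fj - scal (inverse u) (?Fj * ?Fi)"
  have "sends R (idx R) (idx R) Ti (?Fj * ?Fi - scal (inverse u) (?Fi * ?Fj))
      (C * - (?Ei * ?K (- e)) - scal (inverse u) (- (?Ei * ?K (- e)) * C))"
    unfolding C_def by (intro Di Ei Si Ti_i Ti_j)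
  then have "sends R (idx R) (idx R) Ti (?Fj * ?Fi - scal (inverse u) (?Fi * ?Fj))
      (scal (inverse u) (?Ei * ?K (- e) * C) - C * (?Ei * ?K (- e)))"
    by simp
  moreover have "qg_eq R (idx R) (scal (inverse u) (?Ei * ?K (- e) * C) - C * (?Ei * ?K (- e))) ?Fj"
  proof (rule rank_two_cancellation[where m = "\<lambda>p q. q * p" and K' = "?K e" and E = ?Fi])
    show "qg_eq R (idx R) (?Ei * ?Fi)
        (?Fi * ?Ei + scal (inverse (inverse u - u)) (?K (- e) - ?K e))"
      using relation_EF_signed[OF i, of "- e"] e by (auto simp: u_def power_int_minus)
    show "qg_eq R (idx R) (?Ei * ?Fj) (?Fj * ?Ei)"
      by (rule relation_EF_diff) (use i j neq in \<open>auto simp: frag_of_eq\<close>)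
    show "qg_eq R (idx R) (?K (- e) * ?Fj) (scal (inverse u) (?Fj * ?K (- e)))"
      using Ktil_commute(2)[OF R j, of i "- e"] by (simp add: adj u)
    show "qg_eq R (idx R) (?K e * ?Fj) (scal (inverse (inverse u)) (?Fj * ?K e))"
      using Ktil_commute(2)[OF R j, of i e] by (simp add: adj u power_int_minus)
    show "qg_eq R (idx R) (?K (- e) * ?Fi)
        (scal (inverse (inverse u) * inverse (inverse u)) (?Fi * ?K (- e)))"
      using Ktil_commute(2)[OF R i, of i "- e"] by (simp add: self sq')
  qed (use i j u0 cu Ktil_inverse in \<open>simp_all add: C_def\<close>)
  ultimately have "sends R (idx R) (idx R) Ti (?Fj * ?Fi - scal (inverse u) (?Fi * ?Fj)) ?Fj"
    by (rule sends_cong)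
  with Tj_i(2) show "sends R (idx R) (idx R) (Ti \<circ> Tj) ?Fi ?Fj"
    by (rule sends_comp)
qed

section \<open>Linear trees\<close>

locale linear_tree_datum =
  fixes R :: "('i, 'y::ab_group_add, 'x::ab_group_add) root_datum" and i :: "nat \<Rightarrow> 'i" and n :: nat
  assumes root_datum: "is_root_datum R" and tree: "linear_tree R i n"
begin

abbreviation chain :: "nat \<Rightarrow> ('i \<Rightarrow>\<^sub>0 int) set" where
  "chain a \<equiv> chain_idx R i n a"

lemma tree_simple: "a \<in> {1..n} \<Longrightarrow> i a \<in> simples R"
  using tree by (auto simp: linear_tree_def Let_def)

lemma tree_eq_iff: "a \<in> {1..n} \<Longrightarrow> b \<in> {1..n} \<Longrightarrow> i a = i b \<longleftrightarrow> a = b"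
  using tree inj_on_eq_iff[of i "{1..n}" a b] unfolding linear_tree_def Let_def by blast

lemma tree_edge: "1 \<le> a \<Longrightarrow> a < n \<Longrightarrow> edge R (i a) (i (Suc a))"
  using tree tree_simple[of a] tree_simple[of "Suc a"] tree_eq_iff[of a "Suc a"]
  by (simp add: linear_tree_def Let_def edge_def)

lemma tree_orthogonal:
  assumes "a \<in> {2..n}" "b \<in> {1..n}" "b \<noteq> a" "a \<noteq> Suc b" "b \<noteq> Suc a"
  shows "form R (frag_of (i a)) (frag_of (i b)) = 0"
proof -
  have "\<bar>int a - int b\<bar> \<notin> {0, 1}" using assms by auto
  then show ?thesis
    using tree assms unfolding linear_tree_def Let_def by auto
qed

lemma outside_tree_orthogonal:
  "a \<in> {2..n} \<Longrightarrow> k \<in> simples R - i ` {1..n} \<Longrightarrow> form R (frag_of (i a)) (frag_of k) = 0"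
  using tree unfolding linear_tree_def Let_def by blast

lemma chain_simple:
  "a \<le> n \<Longrightarrow> k \<in> simples R \<Longrightarrow> k \<noteq> i a \<Longrightarrow> (a < n \<Longrightarrow> k \<noteq> i (Suc a)) \<Longrightarrow> frag_of k \<in> chain a"
  unfolding chain_idx_def delete_def contract_def by (cases "a = n"; cases "a < n") auto

lemma chain_sum: "a < n \<Longrightarrow> frag_of (i a) + frag_of (i (Suc a)) \<in> chain a"
  by (simp add: chain_idx_def contract_def)

end

text \<open>
  The hypothesis on \<open>S\<close> is indexed by the source \<open>I\<^bsup>(a)\<^esup>\<close> of its inverse, which avoids the truncated
  subtraction \<open>a - 1\<close>. The letter \<open>e\<close> stands for \<open>- \<epsilon>\<close>.
\<close>

locale linear_tree_maps = linear_tree_datum R i n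
  for R :: "('i, 'y::ab_group_add, 'x::ab_group_add) root_datum" and i :: "nat \<Rightarrow> 'i" and n :: nat +
  fixes T S :: "nat \<Rightarrow> ('i \<Rightarrow>\<^sub>0 int, 'y) falg set \<Rightarrow> ('i \<Rightarrow>\<^sub>0 int, 'y) falg set" and e :: int
  assumes n: "n \<ge> 2" and e: "e \<in> {1, - 1}"
    and T: "\<And>a. a \<in> {2..n} \<Longrightarrow> is_braid R (i a) e (T a)"
    and S: "\<And>a. 1 \<le> a \<Longrightarrow> a < n \<Longrightarrow>
      is_S R (i (Suc a)) (chain_idx R i n (Suc a)) (chain_idx R i n a) (S (Suc a))"
begin

section \<open>The inverse reflections shift the tree\<close>

definition S_inv :: "nat \<Rightarrow> ('i \<Rightarrow>\<^sub>0 int, 'y) falg set \<Rightarrow> ('i \<Rightarrow>\<^sub>0 int, 'y) falg set" where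
  "S_inv a = inv_into (carrier (QG R (chain a))) (S a)"

lemma S_inv_alg_hom: "1 \<le> a \<Longrightarrow> a < n \<Longrightarrow> S_inv (Suc a) \<in> alg_hom R (chain a) (chain (Suc a))"
  unfolding S_inv_def using S[of a] by (intro alg_hom_inv_into) (simp_all add: is_S_def)

lemma sends_S_inv:
  assumes "1 \<le> a" "a < n" "sends R (chain (Suc a)) (chain a) (S (Suc a)) p p'"
  shows "sends R (chain a) (chain (Suc a)) (S_inv (Suc a)) p' p"
  unfolding S_inv_def using S[OF assms(1,2)] assms(3)
  by (intro sends_inv_into) (simp_all add: is_S_def)

lemma S_inv_K:
  assumes a: "1 \<le> a" "a < n"
  shows "sends R (chain a) (chain (Suc a)) (S_inv (Suc a)) (gK \<mu>) (gK (refl_Y R (i (Suc a)) \<mu>))"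
proof (rule sends_S_inv[OF a])
  have "i (Suc a) \<in> simples R" using a by (simp add: tree_simple)
  then show "sends R (chain (Suc a)) (chain a) (S (Suc a)) (gK (refl_Y R (i (Suc a)) \<mu>)) (gK \<mu>)"
    using S[OF a] by (simp add: is_S_def sends_def refl_Y_involution[OF root_datum])
qed

text \<open>
  Only the defining formula of \<open>S\<close> is available, so a value of the inverse at \<open>q'\<close> is found by
  exhibiting the vertex \<open>q\<close> of the source with \<open>s q = q'\<close>. The three lemmas that follow treat the
  three kinds of vertices: the contracted one, the one next to it, and those orthogonal to the
  reflecting vertex.
\<close>

lemma S_inv_gen:
  assumes a: "1 \<le> a" "a < n" and g: "g \<in> {gE, gF}"
    and q: "q \<in> chain (Suc a)" "refl_L R (i (Suc a)) q = q'" "q' \<in> chain a"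
  shows "sends R (chain a) (chain (Suc a)) (S_inv (Suc a)) (g q') (g q)"
  by (rule sends_S_inv[OF a]) (use S[OF a] q g in \<open>auto simp: is_S_def sends_def\<close>)

lemma S_inv_sum:
  assumes a: "1 \<le> a" "a < n" and g: "g \<in> {gE, gF}"
  shows "sends R (chain a) (chain (Suc a)) (S_inv (Suc a))
    (g (frag_of (i a) + frag_of (i (Suc a)))) (g (frag_of (i a)))"
proof (rule S_inv_gen[OF a g])
  show "refl_L R (i (Suc a)) (frag_of (i a)) = frag_of (i a) + frag_of (i (Suc a))"
    using refl_L_edge(1)[OF root_datum edge_sym[OF root_datum tree_edge[OF a]]]
    by (simp add: add.commute)
  show "frag_of (i a) \<in> chain (Suc a)"
    by (rule chain_simple) (use a in \<open>simp_all add: tree_simple tree_eq_iff\<close>)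
qed (rule chain_sum[OF a(2)])

lemma S_inv_next:
  assumes a: "1 \<le> a" "Suc a < n" and g: "g \<in> {gE, gF}"
  shows "sends R (chain a) (chain (Suc a)) (S_inv (Suc a))
    (g (frag_of (i (Suc (Suc a))))) (g (frag_of (i (Suc a)) + frag_of (i (Suc (Suc a)))))"
proof (rule S_inv_gen[OF _ _ g])
  show "refl_L R (i (Suc a)) (frag_of (i (Suc a)) + frag_of (i (Suc (Suc a)))) = frag_of (i (Suc (Suc a)))"
    using refl_L_edge(2)[OF root_datum tree_edge] a by simp
  show "frag_of (i (Suc (Suc a))) \<in> chain a"
    by (rule chain_simple) (use a in \<open>simp_all add: tree_simple tree_eq_iff\<close>)
qed (use a in \<open>simp_all add: chain_sum\<close>)

lemma S_inv_fix:
  assumes a: "1 \<le> a" "a < n" and g: "g \<in> {gE, gF}"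
    and q: "frag_of k \<in> chain a" "frag_of k \<in> chain (Suc a)"
    and k: "form R (frag_of (i (Suc a))) (frag_of k) = 0"
  shows "sends R (chain a) (chain (Suc a)) (S_inv (Suc a)) (g (frag_of k)) (g (frag_of k))"
  using refl_L_orthogonal[OF k] q by (intro S_inv_gen[OF a g])

lemma S_inv_fix_tree:
  assumes a: "1 \<le> a" "a < n" and g: "g \<in> {gE, gF}"
    and b: "b \<in> {1..n}" "b \<noteq> a" "b \<noteq> Suc a" "b \<noteq> Suc (Suc a)"
  shows "sends R (chain a) (chain (Suc a)) (S_inv (Suc a)) (g (frag_of (i b))) (g (frag_of (i b)))"
proof (rule S_inv_fix[OF a g])
  have "i b \<noteq> i c" if "c \<in> {1..n}" "c \<in> {a, Suc a, Suc (Suc a)}" for c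
    using that b by (auto simp: tree_eq_iff)
  then show "frag_of (i b) \<in> chain a" "frag_of (i b) \<in> chain (Suc a)"
    using a b(1) by (simp_all add: chain_simple tree_simple)
qed (use a b in \<open>auto intro!: tree_orthogonal\<close>)

definition S_inv_upto :: "nat \<Rightarrow> ('i \<Rightarrow>\<^sub>0 int, 'y) falg set \<Rightarrow> ('i \<Rightarrow>\<^sub>0 int, 'y) falg set" where
  "S_inv_upto a = foldr (\<circ>) (map S_inv (rev [2..<Suc a])) id"

lemma S_inv_upto_1: "S_inv_upto 1 = id"
  by (simp add: S_inv_upto_def)

lemma S_inv_upto_Suc: "1 \<le> a \<Longrightarrow> S_inv_upto (Suc a) = S_inv (Suc a) \<circ> S_inv_upto a"
  by (simp add: S_inv_upto_def)

lemma S_inv_upto_base: "p \<in> carrier (free_alg (chain 1)) \<Longrightarrow> sends R (chain 1) (chain 1) (S_inv_upto 1) p p"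
  unfolding S_inv_upto_1 by (rule sends_id)

lemma S_inv_upto_step:
  assumes "1 \<le> a"
    and "sends R (chain 1) (chain a) (S_inv_upto a) p p'"
    and "sends R (chain a) (chain (Suc a)) (S_inv (Suc a)) p' p''"
  shows "sends R (chain 1) (chain (Suc a)) (S_inv_upto (Suc a)) p p''"
  unfolding S_inv_upto_Suc[OF assms(1)] by (rule sends_comp[OF assms(2,3)])

lemma S_inv_upto_alg_hom: "1 \<le> a \<Longrightarrow> a \<le> n \<Longrightarrow> S_inv_upto a \<in> alg_hom R (chain 1) (chain a)"
proof (induction a rule: dec_induct)
  case base
  show ?case unfolding S_inv_upto_1 by (rule alg_hom_id)
next
  case (step a)
  then have "S_inv_upto a \<in> alg_hom R (chain 1) (chain a)" "a < n" by simp_all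
  then show ?case
    unfolding S_inv_upto_Suc[OF step(1)] by (rule alg_hom_comp[OF _ S_inv_alg_hom[OF step(1)]])
qed

lemma S_inv_upto_K: "1 \<le> a \<Longrightarrow> a \<le> n \<Longrightarrow> sends R (chain 1) (chain a) (S_inv_upto a)
    (gK \<mu>) (gK (foldr (\<lambda>b. refl_Y R (i b)) (rev [2..<Suc a]) \<mu>))"
proof (induction a rule: dec_induct)
  case base
  then show ?case by (simp add: S_inv_upto_base del: One_nat_def)
next
  case (step a)
  then have "foldr (\<lambda>b. refl_Y R (i b)) (rev [2..<Suc (Suc a)]) \<mu>
      = refl_Y R (i (Suc a)) (foldr (\<lambda>b. refl_Y R (i b)) (rev [2..<Suc a]) \<mu>)"
    by simp
  with step show ?case
    using S_inv_upto_step[OF step(1) _ S_inv_K] by (simp del: One_nat_def upt_Suc)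
qed

lemma S_inv_upto_first:
  assumes g: "g \<in> {gE, gF}"
  shows "1 \<le> a \<Longrightarrow> Suc a \<le> n \<Longrightarrow> sends R (chain 1) (chain (Suc a)) (S_inv_upto (Suc a))
    (g (frag_of (i 1) + frag_of (i (Suc 1)))) (g (frag_of (i 1)))"
proof (induction a rule: dec_induct)
  case base
  have "frag_of (i 1) + frag_of (i (Suc 1)) \<in> chain 1"
    using n by (intro chain_sum) simp
  then show ?case
    using base g by (intro S_inv_upto_step[OF _ S_inv_upto_base] S_inv_sum) auto
next
  case (step a)
  then show ?case
    by (intro S_inv_upto_step[OF _ step(3) S_inv_fix_tree[OF _ _ g]]) auto
qed

text \<open>
  The vertex \<open>i\<^sub>m\<^sub>+\<^sub>1\<close> is moved exactly twice. The inverse of \<open>S\<^sub>m\<close> sends it to the contracted vertex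
  \<open>i\<^sub>m + i\<^sub>m\<^sub>+\<^sub>1\<close>, the next one sends this to \<open>i\<^sub>m\<close>; before and after, the vertex is
  orthogonal to the reflecting one.
\<close>

lemma S_inv_upto_tree:
  assumes g: "g \<in> {gE, gF}" and m: "2 \<le> m" "m < n"
  shows "1 \<le> a \<Longrightarrow> a \<le> n \<Longrightarrow> sends R (chain 1) (chain a) (S_inv_upto a) (g (frag_of (i (Suc m))))
    (g (if a < m then frag_of (i (Suc m))
        else if a = m then frag_of (i m) + frag_of (i (Suc m)) else frag_of (i m)))"
    (is "_ \<Longrightarrow> _ \<Longrightarrow> sends R _ _ _ _ (g (?q a))")
proof (induction a rule: dec_induct)
  case base
  have "frag_of (i (Suc m)) \<in> chain 1"
    by (rule chain_simple) (use m in \<open>simp_all add: tree_simple tree_eq_iff\<close>)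
  then have "sends R (chain 1) (chain 1) (S_inv_upto 1) (g (frag_of (i (Suc m)))) (g (frag_of (i (Suc m))))"
    using g by (intro S_inv_upto_base) auto
  then show ?case using m by simp
next
  case (step a)
  then have a: "1 \<le> a" "a < n" by simp_all
  have "sends R (chain a) (chain (Suc a)) (S_inv (Suc a)) (g (?q a)) (g (?q (Suc a)))"
  proof -
    consider "Suc a < m" | "m = Suc a" | "m = a" | "m < a" by linarith
    then show ?thesis
    proof cases
      case 1
      then show ?thesis using S_inv_fix_tree[OF a g, of "Suc m"] m by simp
    next
      case 2
      then show ?thesis using S_inv_next[OF a(1) _ g] m by simp
    next
      case 3
      then show ?thesis using S_inv_sum[OF a g] by simp
    next
      case 4
      then show ?thesis using S_inv_fix_tree[OF a g, of m] m by simp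
    qed
  qed
  with step show ?case
    by (intro S_inv_upto_step) simp_all
qed

lemma S_inv_upto_outside:
  assumes g: "g \<in> {gE, gF}" and k: "k \<in> simples R - i ` {1..n}"
  shows "1 \<le> a \<Longrightarrow> a \<le> n \<Longrightarrow> sends R (chain 1) (chain a) (S_inv_upto a) (g (frag_of k)) (g (frag_of k))"
proof (induction a rule: dec_induct)
  have mem: "frag_of k \<in> chain b" if "b \<in> {1..n}" for b
    by (rule chain_simple) (use that k in auto)
  {
    case base
    show ?case
      using g mem[of 1] n by (intro S_inv_upto_base) auto
  next
    case (step a)
    have "sends R (chain a) (chain (Suc a)) (S_inv (Suc a)) (g (frag_of k)) (g (frag_of k))"
      using step by (intro S_inv_fix g mem outside_tree_orthogonal k) simp_all
    with step show ?case
      by (intro S_inv_upto_step) simp_all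
  }
qed

section \<open>The braid operators undo the shift\<close>

definition braids :: "nat list \<Rightarrow> ('i \<Rightarrow>\<^sub>0 int, 'y) falg set \<Rightarrow> ('i \<Rightarrow>\<^sub>0 int, 'y) falg set" where
  "braids as = foldr (\<circ>) (map T as) id"

lemma braids_Nil: "braids [] = id"
  by (simp add: braids_def)

lemma braids_Cons: "braids (a # as) = T a \<circ> braids as"
  by (simp add: braids_def)

lemma braids_append: "braids (as @ bs) = braids as \<circ> braids bs"
  by (induction as) (simp_all add: braids_Nil braids_Cons comp_assoc)

lemma braids_alg_hom: "set as \<subseteq> {2..n} \<Longrightarrow> braids as \<in> alg_hom R (idx R) (idx R)"
proof (induction as)
  case Nil
  show ?case unfolding braids_Nil by (rule alg_hom_id)
next
  case (Cons a as)
  then have "braids as \<in> alg_hom R (idx R) (idx R)" "a \<in> {2..n}" by simp_all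
  then show ?case
    unfolding braids_Cons by (rule alg_hom_comp[OF _ braid_alg_hom[OF T]])
qed

lemma braids_K: "set as \<subseteq> {2..n} \<Longrightarrow>
    sends R (idx R) (idx R) (braids as) (gK \<mu>) (gK (foldr (\<lambda>b. refl_Y R (i b)) as \<mu>))"
proof (induction as)
  case Nil
  show ?case unfolding braids_Nil by (simp add: sends_def)
next
  case (Cons a as)
  then have "sends R (idx R) (idx R) (braids as) (gK \<mu>) (gK (foldr (\<lambda>b. refl_Y R (i b)) as \<mu>))"
    and a: "a \<in> {2..n}" by simp_all
  from sends_comp[OF this(1) braid_K[OF T[OF a]]] show ?case
    by (simp only: braids_Cons foldr_Cons comp_apply[where x = \<mu>])
qed

lemma braids_fix:
  assumes k: "k \<in> simples R" and g: "g \<in> {gE, gF}"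
    and "\<And>a. a \<in> set as \<Longrightarrow> a \<in> {2..n} \<and> k \<noteq> i a \<and> form R (frag_of (i a)) (frag_of k) = 0"
  shows "sends R (idx R) (idx R) (braids as) (g (frag_of k)) (g (frag_of k))"
  using assms(3)
proof (induction as)
  case Nil
  show ?case using k g unfolding braids_Nil by (intro sends_id) auto
next
  case (Cons a as)
  then have a: "a \<in> {2..n}" "k \<noteq> i a" "form R (frag_of (i a)) (frag_of k) = 0" by simp_all
  then have "i a \<in> simples R" "k \<in> simples R - {i a}"
    using k by (simp_all add: tree_simple)
  then have "sends R (idx R) (idx R) (T a) (g (frag_of k)) (g (frag_of k))"
    using braid_orthogonal[OF root_datum T[OF a(1)] _ _ a(3)] g by auto
  with Cons show ?case
    unfolding braids_Cons by (intro sends_comp) simp_all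
qed

lemma braids_fix_tree:
  assumes "b \<in> {1..n}" "g \<in> {gE, gF}" "set as \<subseteq> {2..n}"
    and "\<And>a. a \<in> set as \<Longrightarrow> Suc b < a \<or> Suc a < b"
  shows "sends R (idx R) (idx R) (braids as) (g (frag_of (i b))) (g (frag_of (i b)))"
proof (rule braids_fix[OF tree_simple[OF assms(1)] assms(2)])
  fix a assume "a \<in> set as"
  then have "a \<in> {2..n}" "a \<noteq> b" "a \<noteq> Suc b" "b \<noteq> Suc a"
    using assms(3,4) by fastforce+
  then show "a \<in> {2..n} \<and> i b \<noteq> i a \<and> form R (frag_of (i a)) (frag_of (i b)) = 0"
    using assms(1) tree_orthogonal[of a b] by (simp add: tree_eq_iff)
qed

lemma braids_first:
  shows "sends R (idx R) (idx R) (braids [2..<Suc n]) (gE (frag_of (i 1)))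
      (gE (frag_of (i 1)) * gE (frag_of (i 2))
        - scal (vpar R (frag_of (i 1)) powi e) (gE (frag_of (i 2)) * gE (frag_of (i 1))))" (is ?E)
    and "sends R (idx R) (idx R) (braids [2..<Suc n]) (gF (frag_of (i 1)))
      (gF (frag_of (i 2)) * gF (frag_of (i 1))
        - scal (vpar R (frag_of (i 1)) powi (- e)) (gF (frag_of (i 1)) * gF (frag_of (i 2))))" (is ?F)
proof -
  have "[2..<Suc n] = 2 # [3..<Suc n]"
    using n by (subst upt_conv_Cons) (simp_all del: upt_Suc)
  then have split_list: "braids [2..<Suc n] = T 2 \<circ> braids [3..<Suc n]"
    by (simp only: braids_Cons)
  have rest: "sends R (idx R) (idx R) (braids [3..<Suc n]) (g (frag_of (i 1))) (g (frag_of (i 1)))"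
    if "g \<in> {gE, gF}" for g
    by (rule braids_fix_tree[OF _ that]) (use n in auto)
  have e12: "edge R (i 1) (i 2)"
    using tree_edge[of 1] n by (simp add: numeral_2_eq_2)
  have T2: "is_braid R (i 2) e (T 2)" using T[of 2] n by simp
  note T2_1 = braid_edge[OF root_datum T2 edge_sym[OF root_datum e12]]
  show ?E
    unfolding split_list edge_vpar[OF e12] by (rule sends_comp[OF rest[of gE] T2_1(1)]) simp
  show ?F
    unfolding split_list edge_vpar[OF e12] power_int_minus by (rule sends_comp[OF rest[of gF] T2_1(2)]) simp
qed

text \<open>
  Reading the product from the right: the operators beyond \<open>m + 1\<close> fix the generators of \<open>i\<^sub>m\<close>, the
  pair \<open>T\<^sub>m T\<^sub>m\<^sub>+\<^sub>1\<close> moves them to \<open>i\<^sub>m\<^sub>+\<^sub>1\<close>, and the operators before \<open>m\<close> fix the latter. The bound \<open>m \<ge> 2\<close>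
  ensures that \<open>T\<^sub>m\<close> is a factor of the product.
\<close>

lemma braids_tree:
  assumes m: "2 \<le> m" "m < n" and g: "g \<in> {gE, gF}"
  shows "sends R (idx R) (idx R) (braids [2..<Suc n]) (g (frag_of (i m))) (g (frag_of (i (Suc m))))"
proof -
  have "[2..<Suc n] = [2..<m] @ [m..<Suc n]"
    using m upt_add_eq_append[of 2 m "Suc n - m"] by simp
  also have "[m..<Suc n] = m # Suc m # [Suc (Suc m)..<Suc n]"
    using m upt_conv_Cons[of m "Suc n"] upt_conv_Cons[of "Suc m" "Suc n"] by simp
  finally have split_list: "braids [2..<Suc n]
      = braids [2..<m] \<circ> ((T m \<circ> T (Suc m)) \<circ> braids [Suc (Suc m)..<Suc n])"
    by (simp only: braids_append braids_Cons comp_assoc)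
  have 1: "sends R (idx R) (idx R) (braids [Suc (Suc m)..<Suc n]) (g (frag_of (i m))) (g (frag_of (i m)))"
    by (rule braids_fix_tree[OF _ g]) (use m in auto)
  have 2: "sends R (idx R) (idx R) (T m \<circ> T (Suc m)) (g (frag_of (i m))) (g (frag_of (i (Suc m))))"
    using braid_braid_edge[OF root_datum tree_edge e T T, of m] m g by auto
  have 3: "sends R (idx R) (idx R) (braids [2..<m]) (g (frag_of (i (Suc m)))) (g (frag_of (i (Suc m))))"
    by (rule braids_fix_tree[OF _ g]) (use m in auto)
  show ?thesis
    unfolding split_list by (rule sends_comp[OF sends_comp[OF 1 2] 3])
qed

lemma braids_outside:
  assumes g: "g \<in> {gE, gF}" and k: "k \<in> simples R - i ` {1..n}"
  shows "sends R (idx R) (idx R) (braids [2..<Suc n]) (g (frag_of k)) (g (frag_of k))"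
proof (rule braids_fix[OF _ g])
  fix a assume "a \<in> set [2..<Suc n]"
  then have "a \<in> {2..n}" by auto
  then show "a \<in> {2..n} \<and> k \<noteq> i a \<and> form R (frag_of (i a)) (frag_of k) = 0"
    using k outside_tree_orthogonal[of a k] by auto
qed (use k in simp)

lemma refl_Y_cancel:
  "set as \<subseteq> {1..n} \<Longrightarrow>
    foldr (\<lambda>b. refl_Y R (i b)) as (foldr (\<lambda>b. refl_Y R (i b)) (rev as) \<mu>) = \<mu>"
  by (induction as arbitrary: \<mu>) (simp_all add: refl_Y_involution[OF root_datum tree_simple])

section \<open>Comparison on generators\<close>

lemma chain_1_cases:
  assumes "q \<in> chain 1"
  obtains "q = frag_of (i 1) + frag_of (i 2)"
    | m where "2 \<le> m" "m < n" "q = frag_of (i (Suc m))"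
    | k where "k \<in> simples R - i ` {1..n}" "q = frag_of k"
proof -
  consider "q = frag_of (i 1) + frag_of (i 2)" | k where "k \<in> simples R - {i 1, i 2}" "q = frag_of k"
    using assms n by (auto simp: chain_idx_def contract_def numeral_2_eq_2)
  then show thesis
  proof cases
    case 1
    then show thesis by (rule that(1))
  next
    case (2 k)
    show thesis
    proof (cases "k \<in> i ` {1..n}")
      case True
      then obtain b where b: "b \<in> {1..n}" "k = i b" by blast
      moreover have "b \<noteq> 1" "b \<noteq> 2" using 2 b by auto
      ultimately have "2 \<le> b - 1" "b - 1 < n" "q = frag_of (i (Suc (b - 1)))"
        using 2 by auto
      then show thesis by (rule that(2))
    next
      case False
      then show thesis using 2 that(3) by blast
    qed
  qed
qed

text \<open>
  The three kinds of generators \<open>E\<^sub>q\<close>, \<open>F\<^sub>q\<close> are first shifted along the tree, then embedded by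
  \<open>\<Upsilon>\<close>, which is possible because no shifted vertex is \<open>i\<^sub>n\<close>, and finally moved back by the braid
  operators.
\<close>

lemma Psi_eq_braids:
  assumes Psi: "is_Psi R (- e) (i 1) (i 2) \<Psi>" and Ups: "is_Upsilon R (i n) \<Upsilon>"
    and x: "x \<in> carrier (QG R (contract R (i 1) (i 2)))"
  shows "\<Psi> x = (braids [2..<Suc n] \<circ> \<Upsilon> \<circ> S_inv_upto n) x"
proof -
  note [simp del] = One_nat_def upt_Suc
  define h where "h = braids [2..<Suc n] \<circ> \<Upsilon> \<circ> S_inv_upto n"
  have chain1: "contract R (i 1) (i 2) = chain 1" and chainn: "delete R (i n) = chain n"
    using n by (simp_all add: chain_idx_def numeral_2_eq_2 One_nat_def)
  have as: "set [2..<Suc n] \<subseteq> {2..n}" "set [2..<Suc n] \<subseteq> {1..n}" by auto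
  have Psi_hom: "\<Psi> \<in> alg_hom R (chain 1) (idx R)"
    and Psi_K: "\<And>\<mu>. \<Psi> (cls R (chain 1) (gK \<mu>)) = cls R (idx R) (gK \<mu>)"
    and Psi_fix: "\<And>g k. g \<in> {gE, gF} \<Longrightarrow> k \<in> simples R - {i 1, i 2} \<Longrightarrow>
      \<Psi> (cls R (chain 1) (g (frag_of k))) = cls R (idx R) (g (frag_of k))"
    and Psi_E: "\<Psi> (cls R (chain 1) (gE (frag_of (i 1) + frag_of (i 2)))) = cls R (idx R)
      (gE (frag_of (i 1)) * gE (frag_of (i 2))
        - scal (vpar R (frag_of (i 1)) powi e) (gE (frag_of (i 2)) * gE (frag_of (i 1))))"
    and Psi_F: "\<Psi> (cls R (chain 1) (gF (frag_of (i 1) + frag_of (i 2)))) = cls R (idx R)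
      (gF (frag_of (i 2)) * gF (frag_of (i 1))
        - scal (vpar R (frag_of (i 1)) powi (- e)) (gF (frag_of (i 1)) * gF (frag_of (i 2))))"
    using Psi unfolding is_Psi_def Let_def chain1 by (auto simp: const_mult_eq_scal)
  have Ups_hom: "\<Upsilon> \<in> alg_hom R (chain n) (idx R)"
    using Ups unfolding is_Upsilon_def Let_def chainn by simp
  have h_hom: "h \<in> alg_hom R (chain 1) (idx R)"
    unfolding h_def
    by (rule alg_hom_comp[OF S_inv_upto_alg_hom alg_hom_comp[OF Ups_hom braids_alg_hom[OF as(1)]]])
      (use n in simp_all)
  have Ups_K: "sends R (chain n) (idx R) \<Upsilon> (gK \<mu>) (gK \<mu>)" for \<mu>
    using Ups unfolding is_Upsilon_def Let_def chainn sends_def by simp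
  have Ups_gen: "sends R (chain n) (idx R) \<Upsilon> (g (frag_of k)) (g (frag_of k))"
    if "k \<in> simples R" "k \<noteq> i n" "g \<in> {gE, gF}" for g k
  proof -
    have "frag_of k \<in> chain n" using that by (simp add: chain_simple)
    then show ?thesis
      using Ups that unfolding is_Upsilon_def Let_def chainn sends_def by auto
  qed
  have h_eq: "h (cls R (chain 1) p) = cls R (idx R) p'"
    if "sends R (chain 1) (chain n) (S_inv_upto n) p r" "sends R (chain n) (idx R) \<Upsilon> r s"
      "sends R (idx R) (idx R) (braids [2..<Suc n]) s p'" for p r s p'
    unfolding h_def by (rule sends_eqD[OF sends_comp[OF that(1) sends_comp[OF that(2,3)], unfolded comp_assoc[symmetric]]])
  have gen: "\<Psi> (cls R (chain 1) (g q)) = h (cls R (chain 1) (g q))"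
    if q: "q \<in> chain 1" and g: "g \<in> {gE, gF}" for g q
    using q
  proof (cases rule: chain_1_cases)
    case 1
    have S1: "sends R (chain 1) (chain n) (S_inv_upto n) (g q) (g (frag_of (i 1)))"
      using S_inv_upto_first[OF g, of "n - 1"] n unfolding 1 by (simp add: numeral_2_eq_2 One_nat_def)
    have U1: "sends R (chain n) (idx R) \<Upsilon> (g (frag_of (i 1))) (g (frag_of (i 1)))"
      by (rule Ups_gen[OF _ _ g]) (use n in \<open>simp_all add: tree_simple tree_eq_iff\<close>)
    from g consider "g = gE" | "g = gF" by blast
    then show ?thesis
    proof cases
      case E: 1
      show ?thesis
        using h_eq[OF S1 U1] braids_first(1) Psi_E unfolding 1 E by simp
    next
      case F: 2
      show ?thesis
        using h_eq[OF S1 U1] braids_first(2) Psi_F unfolding 1 F by simp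
    qed
  next
    case (2 m)
    have Sm: "sends R (chain 1) (chain n) (S_inv_upto n) (g q) (g (frag_of (i m)))"
      using S_inv_upto_tree[OF g 2(1,2), of n] 2 n by simp
    have Um: "sends R (chain n) (idx R) \<Upsilon> (g (frag_of (i m))) (g (frag_of (i m)))"
      by (rule Ups_gen[OF _ _ g]) (use 2 in \<open>simp_all add: tree_simple tree_eq_iff\<close>)
    have "i (Suc m) \<in> simples R - {i 1, i 2}"
      using 2 by (simp add: tree_simple tree_eq_iff)
    then show ?thesis
      using h_eq[OF Sm Um braids_tree[OF 2(1,2) g]] Psi_fix[OF g] 2(3) by simp
  next
    case (3 k)
    have "k \<noteq> i b" if "b \<in> {1..n}" for b using that 3 by auto
    then have k: "k \<in> simples R - {i 1, i 2}" "k \<noteq> i n" using 3 n by auto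
    have Sk: "sends R (chain 1) (chain n) (S_inv_upto n) (g q) (g (frag_of k))"
      using S_inv_upto_outside[OF g 3(1), of n] 3 n by simp
    have Uk: "sends R (chain n) (idx R) \<Upsilon> (g (frag_of k)) (g (frag_of k))"
      using k by (intro Ups_gen[OF _ _ g]) simp_all
    show ?thesis
      using h_eq[OF Sk Uk braids_outside[OF g 3(1)]] Psi_fix[OF g k(1)] 3(2) by simp
  qed
  have K: "\<Psi> (cls R (chain 1) (gK \<mu>)) = h (cls R (chain 1) (gK \<mu>))" for \<mu>
    using h_eq[OF S_inv_upto_K Ups_K braids_K[OF as(1)], of \<mu>] n Psi_K
    by (simp add: refl_Y_cancel[OF as(2)])
  have "\<Psi> x = h x"
  proof (rule alg_hom_unique[OF Psi_hom h_hom])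
    show "\<Psi> (cls R (chain 1) (gE q)) = h (cls R (chain 1) (gE q))" if "q \<in> chain 1" for q
      by (rule gen[OF that]) simp
    show "\<Psi> (cls R (chain 1) (gF q)) = h (cls R (chain 1) (gF q))" if "q \<in> chain 1" for q
      by (rule gen[OF that]) simp
    show "x \<in> carrier (QG R (chain 1))"
      using x by (simp only: chain1)
  qed (rule K)
  then show ?thesis by (simp only: h_def)
qed

end

theorem proposition6p1p3:
  fixes R :: "('i, 'y::ab_group_add, 'x::ab_group_add) root_datum"
    and i :: "nat \<Rightarrow> 'i" and n :: nat and \<epsilon> :: int
    and \<Psi> \<Upsilon> :: "('i \<Rightarrow>\<^sub>0 int, 'y) falg set \<Rightarrow> ('i \<Rightarrow>\<^sub>0 int, 'y) falg set"
    and T' :: "'i \<Rightarrow> int \<Rightarrow> ('i \<Rightarrow>\<^sub>0 int, 'y) falg set \<Rightarrow> ('i \<Rightarrow>\<^sub>0 int, 'y) falg set"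
    and S :: "nat \<Rightarrow> ('i \<Rightarrow>\<^sub>0 int, 'y) falg set \<Rightarrow> ('i \<Rightarrow>\<^sub>0 int, 'y) falg set"
  assumes "is_root_datum R"
    and "n \<ge> 2"
    and "linear_tree R i n"
    and "\<epsilon> \<in> {1, - 1}"
    and "is_Psi R \<epsilon> (i 1) (i 2) \<Psi>"
    and "\<And>a. a \<in> {2..n} \<Longrightarrow> is_braid R (i a) (- \<epsilon>) (T' (i a) (- \<epsilon>))"
    and "is_Upsilon R (i n) \<Upsilon>"
    and "\<And>a. a \<in> {2..n} \<Longrightarrow> is_S R (i a) (chain_idx R i n a) (chain_idx R i n (a - 1)) (S a)"
    and "x \<in> carrier (QG R (contract R (i 1) (i 2)))"
  shows "\<Psi> x =
    (foldr (\<circ>) (map (\<lambda>a. T' (i a) (- \<epsilon>)) [2..<Suc n]) id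
     \<circ> \<Upsilon>
     \<circ> foldr (\<circ>) (map (\<lambda>a. inv_into (carrier (QG R (chain_idx R i n a))) (S a)) (rev [2..<Suc n])) id) x"
proof -
  interpret linear_tree_maps R i n "\<lambda>a. T' (i a) (- \<epsilon>)" S "- \<epsilon>"
    by unfold_locales (use assms(1-4,6) assms(8)[of "Suc _"] in auto)
  have S_inv: "S_inv = (\<lambda>a. inv_into (carrier (QG R (chain_idx R i n a))) (S a))"
    by (rule ext) (simp add: S_inv_def)
  show ?thesis
    using Psi_eq_braids[of \<Psi> \<Upsilon> x] assms(5,7,9)
    unfolding braids_def S_inv_upto_def S_inv by simp
qed

end
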